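(* For any lattice $L$, the following statements are equivalent: (i) $L$ has a join-complete lattice embedding into some complete, lower continuous, join-semidistributive lattice that belongs to the same variety as $L$ (i.e., to the variety of lattices generated by $L$). (ii) $L$ has a lattice embedding into some complete, lower continuous, join-semidistributive lattice. (iii) $L$ has a lattice embedding into some $\aleph_0$-meet-complete, $\aleph_0$-lower continuous, join-semidistributive lattice. (iv) $L$ satisfies the axiom $(\mathrm{SD}_{\vee}^{\omega})$.
   Context: A map $f\colon K\to L$ between posets is join-complete if $x=\bigvee_{i\in I}x_i$ in $K$ implies $f(x)=\bigvee_{i\in I}f(x_i)$ in $L$, for every $x\in K$ and every family $(x_i)_{i\in I}$ of elements of $K$. A lattice is $\aleph_0$-meet-complete if every at most countable subset has a meet. A lattice $L$ is lower continuous if $a\vee\bigwedge X=\bigwedge\{a\vee x\mid x\in X\}$ for every $a\in L$ and every downward directed $X\subseteq L$ such that $\bigwedge X$ exists; $\aleph_0$-lower continuous means the same restricted to at most countable $X$. A lattice is join-semidistributive if $x\vee y=x\vee z$ implies $x\vee y=x\vee(y\wedge z)$. For a set $X$, $X^{<\omega}$ is the set of finite sequences of elements of $X$, $|\boldsymbol{s}|$ is the length of $\boldsymbol{s}$, and ${}^\frown$ is concatenation. Let $L\cup\{1\}$ be $L$ with a new largest element $1$ added. For $a\in L$ and $\boldsymbol{t}\in L^{<\omega}$ define $a*\boldsymbol{t}\in L\cup\{1\}$ by $a*\varnothing=1$ and $a*(\boldsymbol{t}^\frown\langle b\rangle)=a\vee(b\wedge(a*\boldsymbol{t}))$. For $\boldsymbol{s}\in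 L^{<\omega}$ and $x\in L\cup\{1\}$ define $\boldsymbol{s}\mathbin{\lozenge}x$ by $\varnothing\mathbin{\lozenge}x=x$ and $$(\boldsymbol{s}^\frown\langle a\rangle)\mathbin{\lozenge}x=\begin{cases}a\vee(\boldsymbol{s}\mathbin{\lozenge}x)&\text{if }|\boldsymbol{s}|\text{ is even},\\ a\wedge(\boldsymbol{s}\mathbin{\lozenge}x)&\text{if }|\boldsymbol{s}|\text{ is odd}.\end{cases}$$ $L$ satisfies $(\mathrm{SD}_{\vee}^{\omega})$ if for all $\boldsymbol{s}\in L^{<\omega}$ and all $a,b,c\in L$, $$\boldsymbol{s}\mathbin{\lozenge}(a\vee(b\wedge c))=\bigwedge\{\boldsymbol{s}\mathbin{\lozenge}(a*\boldsymbol{t})\mid\boldsymbol{t}\in\{b,c\}^{<\omega}\},$$ meaning that the right-hand side meet exists and equals the left-hand side. *)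

theory Defs
  imports "HOL-Algebra.Complete_Lattice" "HOL-Library.Countable_Set"
begin

section \<open>Continuity and semidistributivity\<close>

definition countably_meet_complete :: "('a, 'm) gorder_scheme \<Rightarrow> bool" where
  "countably_meet_complete L \<longleftrightarrow>
     (\<forall>X \<subseteq> carrier L. countable X \<longrightarrow> (\<exists>m. is_glb L m X))"

definition down_directed :: "('a, 'm) gorder_scheme \<Rightarrow> 'a set \<Rightarrow> bool" where
  "down_directed L X \<longleftrightarrow>
     X \<noteq> {} \<and> (\<forall>x\<in>X. \<forall>y\<in>X. \<exists>z\<in>X. z \<sqsubseteq>\<^bsub>L\<^esub> x \<and> z \<sqsubseteq>\<^bsub>L\<^esub> y)"

definition lower_continuous :: "('a, 'm) gorder_scheme \<Rightarrow> bool" where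
  "lower_continuous L \<longleftrightarrow>
     (\<forall>a \<in> carrier L. \<forall>X \<subseteq> carrier L. \<forall>m. down_directed L X \<longrightarrow> is_glb L m X \<longrightarrow>
        is_glb L (a \<squnion>\<^bsub>L\<^esub> m) {a \<squnion>\<^bsub>L\<^esub> x | x. x \<in> X})"

definition countably_lower_continuous :: "('a, 'm) gorder_scheme \<Rightarrow> bool" where
  "countably_lower_continuous L \<longleftrightarrow>
     (\<forall>a \<in> carrier L. \<forall>X \<subseteq> carrier L. \<forall>m.
        countable X \<longrightarrow> down_directed L X \<longrightarrow> is_glb L m X \<longrightarrow>
        is_glb L (a \<squnion>\<^bsub>L\<^esub> m) {a \<squnion>\<^bsub>L\<^esub> x | x. x \<in> X})"

definition join_semidistributive :: "('a, 'm) gorder_scheme \<Rightarrow> bool" where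
  "join_semidistributive L \<longleftrightarrow>
     (\<forall>x \<in> carrier L. \<forall>y \<in> carrier L. \<forall>z \<in> carrier L.
        x \<squnion>\<^bsub>L\<^esub> y = x \<squnion>\<^bsub>L\<^esub> z \<longrightarrow> x \<squnion>\<^bsub>L\<^esub> y = x \<squnion>\<^bsub>L\<^esub> (y \<sqinter>\<^bsub>L\<^esub> z))"


section \<open>Maps between lattices\<close>

definition lattice_embedding ::
  "('a, 'm) gorder_scheme \<Rightarrow> ('b, 'n) gorder_scheme \<Rightarrow> ('a \<Rightarrow> 'b) \<Rightarrow> bool" where
  "lattice_embedding K L f \<longleftrightarrow>
     f \<in> carrier K \<rightarrow> carrier L \<and> inj_on f (carrier K) \<and> join_pres K L f \<and> meet_pres K L f"

text \<open>A family of elements matters here only through its range, so families are rendered as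
  subsets. The empty family is included: a least element, if there is one, is preserved.\<close>

definition join_complete ::
  "('a, 'm) gorder_scheme \<Rightarrow> ('b, 'n) gorder_scheme \<Rightarrow> ('a \<Rightarrow> 'b) \<Rightarrow> bool" where
  "join_complete K L f \<longleftrightarrow>
     (\<forall>x. \<forall>X \<subseteq> carrier K. is_lub K x X \<longrightarrow> is_lub L (f x) (f ` X))"


section \<open>The variety generated by a lattice\<close>

datatype lterm = LVar nat | LJoin lterm lterm | LMeet lterm lterm

primrec lterm_val :: "('a, 'm) gorder_scheme \<Rightarrow> (nat \<Rightarrow> 'a) \<Rightarrow> lterm \<Rightarrow> 'a" where
  "lterm_val L v (LVar n) = v n"
| "lterm_val L v (LJoin p q) = lterm_val L v p \<squnion>\<^bsub>L\<^esub> lterm_val L v q"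
| "lterm_val L v (LMeet p q) = lterm_val L v p \<sqinter>\<^bsub>L\<^esub> lterm_val L v q"

definition satisfies_identities ::
  "('a, 'm) gorder_scheme \<Rightarrow> (lterm \<times> lterm) set \<Rightarrow> bool" where
  "satisfies_identities L S \<longleftrightarrow>
     (\<forall>(p, q) \<in> S. \<forall>v. range v \<subseteq> carrier L \<longrightarrow> lterm_val L v p = lterm_val L v q)"

text \<open>A variety of lattices is the class of all lattices that satisfy some set of identities;
  \<open>K\<close> belongs to the variety generated by \<open>L\<close> if it belongs to every variety containing \<open>L\<close>.\<close>

definition in_variety_generated_by ::
  "('b, 'n) gorder_scheme \<Rightarrow> ('a, 'm) gorder_scheme \<Rightarrow> bool" where
  "in_variety_generated_by K L \<longleftrightarrow>
     lattice K \<and> (\<forall>S. satisfies_identities L S \<longrightarrow> satisfies_identities K S)"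


section \<open>The axiom SD-join-omega\<close>

text \<open>\<open>L \<union> {1}\<close>, with \<open>None\<close> as the new largest element (added even if \<open>L\<close> already has one).\<close>

definition add_top :: "('a, 'm) gorder_scheme \<Rightarrow> 'a option gorder" where
  "add_top L =
     \<lparr> carrier = insert None (Some ` carrier L),
       eq = (=),
       le = (\<lambda>x y. case y of None \<Rightarrow> True
                   | Some b \<Rightarrow> (case x of None \<Rightarrow> False | Some a \<Rightarrow> a \<sqsubseteq>\<^bsub>L\<^esub> b)) \<rparr>"

definition star :: "('a, 'm) gorder_scheme \<Rightarrow> 'a \<Rightarrow> 'a list \<Rightarrow> 'a option" where
  "star L a t =
     foldl (\<lambda>y b. Some a \<squnion>\<^bsub>add_top L\<^esub> (Some b \<sqinter>\<^bsub>add_top L\<^esub> y)) None t"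

definition lozenge :: "('a, 'm) gorder_scheme \<Rightarrow> 'a list \<Rightarrow> 'a option \<Rightarrow> 'a option" where
  "lozenge L s x =
     foldl (\<lambda>y (n, a). if even n then Some a \<squnion>\<^bsub>add_top L\<^esub> y else Some a \<sqinter>\<^bsub>add_top L\<^esub> y)
       x (List.enumerate 0 s)"

text \<open>The recursive equations by which the two operations are usually introduced.\<close>

lemma star_simps:
  "star L a [] = None"
  "star L a (t @ [b]) = Some a \<squnion>\<^bsub>add_top L\<^esub> (Some b \<sqinter>\<^bsub>add_top L\<^esub> star L a t)"
  by (simp_all add: star_def)

lemma lozenge_simps:
  "lozenge L [] x = x"
  "lozenge L (s @ [a]) x =
     (if even (length s) then Some a \<squnion>\<^bsub>add_top L\<^esub> lozenge L s x
      else Some a \<sqinter>\<^bsub>add_top L\<^esub> lozenge L s x)"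
  by (simp_all add: lozenge_def enumerate_append_eq)

definition SD_join_omega :: "('a, 'm) gorder_scheme \<Rightarrow> bool" where
  "SD_join_omega L \<longleftrightarrow>
     (\<forall>s \<in> lists (carrier L). \<forall>a \<in> carrier L. \<forall>b \<in> carrier L. \<forall>c \<in> carrier L.
        is_glb (add_top L) (lozenge L s (Some (a \<squnion>\<^bsub>L\<^esub> (b \<sqinter>\<^bsub>L\<^esub> c))))
          {lozenge L s (star L a t) | t. t \<in> lists {b, c}})"


section \<open>The embeddability conditions\<close>

text \<open>HOL cannot quantify over all lattices inside a formula, only over those with carrier in a
  given type; the type argument of the following conditions is where the target lattice lives.
  The theorem about them is to be read as follows: whatever the type \<open>'b\<close>, a target lattice
  in \<open>'b\<close> forces the axiom, while the axiom (equivalently, a target in any type at all) already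
  provides one with carrier in \<open>'a set\<close>, where \<open>'a\<close> is the type of the elements of \<open>L\<close>.\<close>

definition embeds_join_complete_in_variety :: "'b itself \<Rightarrow> ('a, 'm) gorder_scheme \<Rightarrow> bool" where
  "embeds_join_complete_in_variety (_ :: 'b itself) L \<longleftrightarrow>
     (\<exists>(K :: 'b gorder) f.
        complete_lattice K \<and> lower_continuous K \<and> join_semidistributive K \<and>
        in_variety_generated_by K L \<and> lattice_embedding L K f \<and> join_complete L K f)"

definition embeds_complete :: "'b itself \<Rightarrow> ('a, 'm) gorder_scheme \<Rightarrow> bool" where
  "embeds_complete (_ :: 'b itself) L \<longleftrightarrow>
     (\<exists>(K :: 'b gorder) f.
        complete_lattice K \<and> lower_continuous K \<and> join_semidistributive K \<and>
        lattice_embedding L K f)"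

definition embeds_countably_complete :: "'b itself \<Rightarrow> ('a, 'm) gorder_scheme \<Rightarrow> bool" where
  "embeds_countably_complete (_ :: 'b itself) L \<longleftrightarrow>
     (\<exists>(K :: 'b gorder) f.
        lattice K \<and> countably_meet_complete K \<and> countably_lower_continuous K \<and>
        join_semidistributive K \<and> lattice_embedding L K f)"

end

theory Submission
  imports Defs
begin

text \<open>If \<open>L\<close> lies in a lattice \<open>K\<close> as in (iii), the elements \<open>a * t\<close> form a countable directed
  family in \<open>K\<close>. By lower continuity its meet \<open>d\<close> satisfies
  \<open>a \<or> (b \<and> d) = d = a \<or> (c \<and> d)\<close>, so that semidistributivity yields \<open>d = a \<or> (b \<and> c)\<close>; the
  operation \<open>\<lozenge>\<close> preserves countable directed meets.

  Conversely, let \<open>K\<close> consist of those filters of \<open>L\<close>, ordered by reverse inclusion, that contain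
  \<open>s \<lozenge> (a \<or> (b \<and> c))\<close> whenever they contain all \<open>s \<lozenge> (a * t)\<close>. The axiom says that principal
  filters are of this kind. As the family of these closure rules is stable under joins and meets
  with a fixed element, the closure is a homomorphism from the lattice of all filters, whence \<open>K\<close>
  inherits lower continuity and the identities of \<open>L\<close>. It is join-semidistributive: if
  \<open>A \<inter> B = A \<inter> C = D\<close> and \<open>x \<in> A\<close> lies above \<open>b \<and> c\<close> with \<open>b \<in> B\<close> and \<open>c \<in> C\<close>, then all
  \<open>x * t\<close> are in \<open>D\<close> by induction on \<open>t\<close>, hence so is \<open>x \<or> (b \<and> c) = x\<close>.\<close>

section \<open>Lattices in terms of carriers\<close>

lemma is_glb_iff:
  assumes "X \<subseteq> carrier L"
  shows "is_glb L m X \<longleftrightarrow> m \<in> carrier L \<and> (\<forall>x\<in>X. m \<sqsubseteq>\<^bsub>L\<^esub> x) \<and>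
    (\<forall>y\<in>carrier L. (\<forall>x\<in>X. y \<sqsubseteq>\<^bsub>L\<^esub> x) \<longrightarrow> y \<sqsubseteq>\<^bsub>L\<^esub> m)"
  using assms unfolding greatest_def Lower_def by blast

lemma is_lub_iff:
  assumes "X \<subseteq> carrier L"
  shows "is_lub L m X \<longleftrightarrow> m \<in> carrier L \<and> (\<forall>x\<in>X. x \<sqsubseteq>\<^bsub>L\<^esub> m) \<and>
    (\<forall>y\<in>carrier L. (\<forall>x\<in>X. x \<sqsubseteq>\<^bsub>L\<^esub> y) \<longrightarrow> m \<sqsubseteq>\<^bsub>L\<^esub> y)"
  using assms unfolding least_def Upper_def by blast

context lattice
begin

lemma join_eqI:
  assumes "x \<in> carrier L" "y \<in> carrier L" "z \<in> carrier L" "x \<sqsubseteq> z" "y \<sqsubseteq> z"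
    and "\<And>w. w \<in> carrier L \<Longrightarrow> x \<sqsubseteq> w \<Longrightarrow> y \<sqsubseteq> w \<Longrightarrow> z \<sqsubseteq> w"
  shows "x \<squnion> y = z"
  using assms by (meson join_closed join_le join_left join_right le_antisym)

lemma meet_eqI:
  assumes "x \<in> carrier L" "y \<in> carrier L" "z \<in> carrier L" "z \<sqsubseteq> x" "z \<sqsubseteq> y"
    and "\<And>w. w \<in> carrier L \<Longrightarrow> w \<sqsubseteq> x \<Longrightarrow> w \<sqsubseteq> y \<Longrightarrow> w \<sqsubseteq> z"
  shows "x \<sqinter> y = z"
  using assms by (meson meet_closed meet_le meet_left meet_right le_antisym)

lemma join_le_iff:
  assumes "x \<in> carrier L" "y \<in> carrier L" "z \<in> carrier L"
  shows "x \<squnion> y \<sqsubseteq> z \<longleftrightarrow> x \<sqsubseteq> z \<and> y \<sqsubseteq> z"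
  using assms by (meson join_closed join_le join_left join_right le_trans)

lemma le_meet_iff:
  assumes "x \<in> carrier L" "y \<in> carrier L" "z \<in> carrier L"
  shows "z \<sqsubseteq> x \<sqinter> y \<longleftrightarrow> z \<sqsubseteq> x \<and> z \<sqsubseteq> y"
  using assms by (meson meet_closed meet_le meet_left meet_right le_trans)

lemma le_joinI1: "x \<sqsubseteq> y \<Longrightarrow> x \<in> carrier L \<Longrightarrow> y \<in> carrier L \<Longrightarrow> z \<in> carrier L \<Longrightarrow> x \<sqsubseteq> y \<squnion> z"
  by (meson join_closed join_left le_trans)

lemma le_joinI2: "x \<sqsubseteq> z \<Longrightarrow> x \<in> carrier L \<Longrightarrow> y \<in> carrier L \<Longrightarrow> z \<in> carrier L \<Longrightarrow> x \<sqsubseteq> y \<squnion> z"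
  by (meson join_closed join_right le_trans)

lemma meet_leI1: "x \<sqsubseteq> z \<Longrightarrow> x \<in> carrier L \<Longrightarrow> y \<in> carrier L \<Longrightarrow> z \<in> carrier L \<Longrightarrow> x \<sqinter> y \<sqsubseteq> z"
  by (meson meet_closed meet_left le_trans)

lemma meet_leI2: "y \<sqsubseteq> z \<Longrightarrow> x \<in> carrier L \<Longrightarrow> y \<in> carrier L \<Longrightarrow> z \<in> carrier L \<Longrightarrow> x \<sqinter> y \<sqsubseteq> z"
  by (meson meet_closed meet_right le_trans)

lemma join_mono:
  assumes "x \<sqsubseteq> x'" "y \<sqsubseteq> y'"
    "x \<in> carrier L" "y \<in> carrier L" "x' \<in> carrier L" "y' \<in> carrier L"
  shows "x \<squnion> y \<sqsubseteq> x' \<squnion> y'"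
  using assms by (simp add: join_le_iff le_joinI1 le_joinI2)

lemma meet_mono:
  assumes "x \<sqsubseteq> x'" "y \<sqsubseteq> y'"
    "x \<in> carrier L" "y \<in> carrier L" "x' \<in> carrier L" "y' \<in> carrier L"
  shows "x \<sqinter> y \<sqsubseteq> x' \<sqinter> y'"
  using assms by (simp add: le_meet_iff meet_leI1 meet_leI2)

lemma lterm_val_closed:
  "range v \<subseteq> carrier L \<Longrightarrow> lterm_val L v p \<in> carrier L"
  by (induction p) auto

lemma lterm_val_mono:
  assumes "range v \<subseteq> carrier L" "range w \<subseteq> carrier L" "\<And>i. v i \<sqsubseteq> w i"
  shows "lterm_val L v p \<sqsubseteq> lterm_val L w p"
  using assms by (induction p) (auto simp: lterm_val_closed intro!: join_mono meet_mono)

end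


section \<open>Adding a largest element\<close>

lemma carrier_add_top [simp]: "carrier (add_top L) = insert None (Some ` carrier L)"
  by (simp add: add_top_def)

lemma le_add_top [simp]:
  "x \<sqsubseteq>\<^bsub>add_top L\<^esub> None"
  "\<not> None \<sqsubseteq>\<^bsub>add_top L\<^esub> Some b"
  "Some a \<sqsubseteq>\<^bsub>add_top L\<^esub> Some b \<longleftrightarrow> a \<sqsubseteq>\<^bsub>L\<^esub> b"
  by (simp_all add: add_top_def)

context lattice
begin

lemma lattice_add_top: "lattice (add_top L)"
proof -
  have po: "partial_order (add_top L)"
    by (unfold_locales) (auto simp: add_top_def split: option.splits intro: le_antisym le_trans)
  have lub: "\<exists>s. is_lub (add_top L) s {x, y}"
    if "x \<in> carrier (add_top L)" "y \<in> carrier (add_top L)" for x y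
  proof (cases "x = None \<or> y = None")
    case True
    with that have "is_lub (add_top L) None {x, y}"
      by (auto simp: is_lub_iff)
    then show ?thesis ..
  next
    case False
    with that obtain a b where "x = Some a" "y = Some b" "a \<in> carrier L" "b \<in> carrier L"
      by auto
    then have "is_lub (add_top L) (Some (a \<squnion> b)) {x, y}"
      by (auto simp: is_lub_iff join_left join_right join_le)
    then show ?thesis ..
  qed
  have glb: "\<exists>s. is_glb (add_top L) s {x, y}"
    if "x \<in> carrier (add_top L)" "y \<in> carrier (add_top L)" for x y
  proof (cases "x = None \<or> y = None")
    case True
    with that have "is_glb (add_top L) (if x = None then y else x) {x, y}"
      by (auto simp: is_glb_iff)
    then show ?thesis ..
  next
    case False
    with that obtain a b where "x = Some a" "y = Some b" "a \<in> carrier L" "b \<in> carrier L"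
      by auto
    then have "is_glb (add_top L) (Some (a \<sqinter> b)) {x, y}"
      by (auto simp: is_glb_iff meet_left meet_right meet_le)
    then show ?thesis ..
  qed
  interpret partial_order "add_top L" by (rule po)
  show ?thesis
    by unfold_locales (use lub glb in auto)
qed

interpretation add_top: lattice "add_top L"
  by (rule lattice_add_top)

lemma join_add_top [simp]:
  "x \<in> carrier (add_top L) \<Longrightarrow> None \<squnion>\<^bsub>add_top L\<^esub> x = None"
  "x \<in> carrier (add_top L) \<Longrightarrow> x \<squnion>\<^bsub>add_top L\<^esub> None = None"
  "a \<in> carrier L \<Longrightarrow> b \<in> carrier L \<Longrightarrow> Some a \<squnion>\<^bsub>add_top L\<^esub> Some b = Some (a \<squnion> b)"
  by (rule add_top.join_eqI; auto simp: join_left join_right join_le)+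

lemma meet_add_top [simp]:
  "x \<in> carrier (add_top L) \<Longrightarrow> None \<sqinter>\<^bsub>add_top L\<^esub> x = x"
  "x \<in> carrier (add_top L) \<Longrightarrow> x \<sqinter>\<^bsub>add_top L\<^esub> None = x"
  "a \<in> carrier L \<Longrightarrow> b \<in> carrier L \<Longrightarrow> Some a \<sqinter>\<^bsub>add_top L\<^esub> Some b = Some (a \<sqinter> b)"
  by (rule add_top.meet_eqI; auto simp: meet_left meet_right meet_le)+

lemma star_closed:
  assumes "a \<in> carrier L" "t \<in> lists (carrier L)"
  shows "star L a t \<in> carrier (add_top L)"
  using assms(2)
proof (induction t rule: rev_induct)
  case (snoc b t)
  then have "star L a t \<in> carrier (add_top L)" "Some b \<in> carrier (add_top L)"
    "Some a \<in> carrier (add_top L)"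
    using assms by auto
  then show ?case
    by (simp only: star_simps add_top.join_closed add_top.meet_closed)
qed (simp add: star_simps)

lemma lozenge_closed:
  assumes "s \<in> lists (carrier L)" "x \<in> carrier (add_top L)"
  shows "lozenge L s x \<in> carrier (add_top L)"
  using assms(1)
proof (induction s rule: rev_induct)
  case (snoc b s)
  then have "lozenge L s x \<in> carrier (add_top L)" "Some b \<in> carrier (add_top L)"
    by auto
  then show ?case
    by (simp only: lozenge_simps add_top.join_closed add_top.meet_closed split: if_splits) simp
qed (use assms in \<open>simp add: lozenge_simps\<close>)

text \<open>Every operand lies in \<open>L\<close>, so \<open>None\<close> can only come from a
  start at \<open>None\<close>. Hence the left-hand sides of the axiom are elements of
  \<open>L\<close>.\<close>

lemma lozenge_Some:
  assumes "s \<in> lists (carrier L)" "x \<in> carrier L"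
  shows "lozenge L s (Some x) \<in> Some ` carrier L"
  using assms(1)
proof (induction s rule: rev_induct)
  case (snoc b s)
  then show ?case by (auto simp: lozenge_simps)
qed (use assms in \<open>simp add: lozenge_simps\<close>)

end


section \<open>Countable directed meets\<close>

text \<open>The side conditions travel with the meet: they must hold again for the image family
  before continuity can be applied a second time.\<close>

definition countable_directed_glb :: "('a, 'm) gorder_scheme \<Rightarrow> 'a set \<Rightarrow> 'a \<Rightarrow> bool" where
  "countable_directed_glb K X m \<longleftrightarrow>
     X \<subseteq> carrier K \<and> countable X \<and> down_directed K X \<and> is_glb K m X"

text \<open>The target of condition (iii), the weakest of the three.\<close>

locale countably_continuous_lattice = lattice K for K (structure) +
  assumes meets: "countably_meet_complete K"
    and continuous: "countably_lower_continuous K"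
    and semidistributive: "join_semidistributive K"
begin

lemma down_directed_image:
  assumes "down_directed K X" "X \<subseteq> carrier K"
    and "\<And>x y. x \<in> carrier K \<Longrightarrow> y \<in> carrier K \<Longrightarrow> x \<sqsubseteq> y \<Longrightarrow> f x \<sqsubseteq> f y"
  shows "down_directed K (f ` X)"
  using assms unfolding down_directed_def by (simp add: subset_iff) metis

lemma countable_directed_glb_join:
  assumes "countable_directed_glb K X m" "a \<in> carrier K"
  shows "countable_directed_glb K ((\<lambda>x. a \<squnion> x) ` X) (a \<squnion> m)"
proof -
  have X: "X \<subseteq> carrier K" "countable X" "down_directed K X" "is_glb K m X"
    using assms by (auto simp: countable_directed_glb_def)
  have "is_glb K (a \<squnion> m) {a \<squnion> x | x. x \<in> X}"
    using continuous X assms(2) unfolding countably_lower_continuous_def by blast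
  moreover have "{a \<squnion> x | x. x \<in> X} = (\<lambda>x. a \<squnion> x) ` X"
    by auto
  moreover have "down_directed K ((\<lambda>x. a \<squnion> x) ` X)"
    using assms by (intro down_directed_image X) (auto intro: join_mono)
  ultimately show ?thesis
    using X assms(2) by (auto simp: countable_directed_glb_def)
qed

text \<open>As \<open>X\<close> is nonempty, a common lower bound of all
  \<open>a \<sqinter> x\<close> lies below \<open>a\<close> and below every
  \<open>x\<close>.\<close>

lemma countable_directed_glb_meet:
  assumes "countable_directed_glb K X m" "a \<in> carrier K"
  shows "countable_directed_glb K ((\<lambda>x. a \<sqinter> x) ` X) (a \<sqinter> m)"
proof -
  have X: "X \<subseteq> carrier K" "countable X" "down_directed K X" "is_glb K m X" "X \<noteq> {}"
    using assms by (auto simp: countable_directed_glb_def down_directed_def)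
  have m: "m \<in> carrier K" "\<And>x. x \<in> X \<Longrightarrow> m \<sqsubseteq> x"
    "\<And>y. y \<in> carrier K \<Longrightarrow> (\<And>x. x \<in> X \<Longrightarrow> y \<sqsubseteq> x) \<Longrightarrow> y \<sqsubseteq> m"
    using X(4) by (auto simp: is_glb_iff[OF X(1)])
  have "is_glb K (a \<sqinter> m) ((\<lambda>x. a \<sqinter> x) ` X)"
  proof (subst is_glb_iff, use X assms in force, intro conjI ballI impI)
    fix y assume y: "y \<in> carrier K" "\<forall>x\<in>(\<lambda>x. a \<sqinter> x) ` X. y \<sqsubseteq> x"
    then have "y \<sqsubseteq> a \<and> y \<sqsubseteq> x" if "x \<in> X" for x
      using that X(1) assms(2) by (auto simp: le_meet_iff subset_iff)
    then show "y \<sqsubseteq> a \<sqinter> m"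
      using X(5) m y(1) assms(2) by (auto simp: le_meet_iff)
  qed (use X m assms in \<open>auto intro!: meet_mono\<close>)
  moreover have "down_directed K ((\<lambda>x. a \<sqinter> x) ` X)"
    using assms by (intro down_directed_image X) (auto intro: meet_mono)
  ultimately show ?thesis
    using X assms(2) by (auto simp: countable_directed_glb_def)
qed

text \<open>\<open>stair u\<close> and \<open>zigzag\<close> are \<open>star\<close> and \<open>lozenge\<close> computed in \<open>K\<close>, whose own largest
  element \<open>u\<close> takes the role of the new one.\<close>

definition stair :: "'a \<Rightarrow> 'a \<Rightarrow> 'a list \<Rightarrow> 'a" where
  "stair u a t = foldl (\<lambda>y b. a \<squnion> (b \<sqinter> y)) u t"

lemma stair_simps:
  "stair u a [] = u" "stair u a (t @ [b]) = a \<squnion> (b \<sqinter> stair u a t)"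
  by (simp_all add: stair_def)

lemma stair_closed:
  "u \<in> carrier K \<Longrightarrow> a \<in> carrier K \<Longrightarrow> \<forall>b\<in>set t. b \<in> carrier K \<Longrightarrow> stair u a t \<in> carrier K"
  by (induction t rule: rev_induct) (auto simp: stair_simps)

lemma stair_ge:
  "u \<in> carrier K \<Longrightarrow> a \<in> carrier K \<Longrightarrow> t \<in> lists (carrier K) \<Longrightarrow> a \<sqsubseteq> u \<Longrightarrow> a \<sqsubseteq> stair u a t"
  by (cases t rule: rev_cases) (auto simp: stair_simps stair_closed join_left)

text \<open>A staircase can be restarted at any of its values; this yields directedness by
  concatenation.\<close>

lemma stair_append: "stair u a (t @ t') = stair (stair u a t) a t'"
  by (simp add: stair_def)

lemma stair_mono:
  assumes "u \<sqsubseteq> v" "u \<in> carrier K" "v \<in> carrier K" "a \<in> carrier K" "t \<in> lists (carrier K)"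
  shows "stair u a t \<sqsubseteq> stair v a t"
  using assms by (induction t rule: rev_induct)
    (auto simp: stair_simps stair_closed intro!: join_mono meet_mono)

text \<open>Once the previous value is at most \<open>u\<close>, both \<open>a\<close> and
  \<open>b \<sqinter> y\<close> are at most \<open>u\<close>.\<close>

lemma stair_le:
  assumes "a \<sqsubseteq> u" "u \<in> carrier K" "a \<in> carrier K" "t \<in> lists (carrier K)"
  shows "stair u a t \<sqsubseteq> u"
  using assms(4)
proof (induction t rule: rev_induct)
  case (snoc b t)
  then show ?case
    using assms by (auto simp: stair_simps stair_closed join_le_iff intro!: meet_leI2)
qed (use assms in \<open>auto simp: stair_simps\<close>)

lemma stair_directed_glb:
  assumes a: "a \<in> carrier K" and b: "b \<in> carrier K" and c: "c \<in> carrier K"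
    and u: "u \<in> carrier K" "\<And>x. x \<in> carrier K \<Longrightarrow> x \<sqsubseteq> u"
  shows "countable_directed_glb K (stair u a ` lists {b, c}) (a \<squnion> (b \<sqinter> c))"
proof -
  let ?T = "lists {b, c}" and ?S = "stair u a ` lists {b, c}"
  have T: "t \<in> lists (carrier K)" if "t \<in> ?T" for t
    using that b c by (induction t) auto
  have S: "?S \<subseteq> carrier K"
    using a b c u by (auto intro!: stair_closed)
  have count: "countable ?S"
    by (intro countable_image countable_lists) simp
  have directed: "down_directed K ?S"
    unfolding down_directed_def
  proof (intro conjI ballI)
    show "?S \<noteq> {}" by blast
    fix x y assume "x \<in> ?S" "y \<in> ?S"
    then obtain t t' where t: "t \<in> ?T" "x = stair u a t" and t': "t' \<in> ?T" "y = stair u a t'"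
      by blast
    \<comment> \<open>The continuation by \<open>t'\<close> starts at \<open>x\<close>, which lies
      above \<open>a\<close>, and no staircase rises above its start.\<close>
    have "stair u a (t @ t') \<sqsubseteq> x"
      unfolding t stair_append using T t t' a u by (intro stair_le stair_ge stair_closed) auto
    \<comment> \<open>Starting at \<open>x\<close> instead of the larger \<open>u\<close> can only
      lower the value reached by \<open>t'\<close>.\<close>
    moreover have "stair u a (t @ t') \<sqsubseteq> y"
      unfolding t' stair_append using T[OF t(1)] T[OF t'(1)] a u
      by (intro stair_mono stair_le stair_closed) auto
    moreover have "stair u a (t @ t') \<in> ?S"
      using t t' by auto
    ultimately show "\<exists>z\<in>?S. z \<sqsubseteq> x \<and> z \<sqsubseteq> y"
      by blast
  qed
  obtain d where d: "is_glb K d ?S"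
    using meets S count unfolding countably_meet_complete_def by blast
  have d_carrier: "d \<in> carrier K" and d_le: "\<And>t. t \<in> ?T \<Longrightarrow> d \<sqsubseteq> stair u a t"
    and d_greatest: "\<And>y. y \<in> carrier K \<Longrightarrow> (\<And>t. t \<in> ?T \<Longrightarrow> y \<sqsubseteq> stair u a t) \<Longrightarrow> y \<sqsubseteq> d"
    using d by (auto simp: is_glb_iff[OF S])
  have ge: "a \<squnion> (b \<sqinter> c) \<sqsubseteq> stair u a t" if "t \<in> ?T" for t
    using that
  proof (induction t rule: rev_induct)
    case Nil
    then show ?case using a b c u by (simp add: stair_simps)
  next
    case (snoc e t)
    then have t: "t \<in> ?T" and e: "e = b \<or> e = c"
      by auto
    have st: "stair u a t \<in> carrier K" "e \<in> carrier K"
      using T[OF t] a b c e u by (auto simp: stair_closed)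
    have "b \<sqinter> c \<sqsubseteq> stair u a t"
      using snoc.IH[OF t] a b c st by (simp add: join_le_iff)
    moreover have "b \<sqinter> c \<sqsubseteq> e"
      using e b c meet_left meet_right by blast
    ultimately show ?case
      unfolding stair_simps using a b c st by (intro join_mono) (auto simp: le_meet_iff)
  qed
  have ge_d: "a \<squnion> (b \<sqinter> c) \<sqsubseteq> d"
    using a b c ge by (intro d_greatest) auto
  have a_d: "a \<sqsubseteq> d" and bc_d: "b \<sqinter> c \<sqsubseteq> d"
    using ge_d a b c d_carrier by (auto simp: join_le_iff)
  have S_glb: "countable_directed_glb K ?S d"
    using S count directed d by (simp add: countable_directed_glb_def)
  \<comment> \<open>By continuity \<open>d\<close> is a fixed point of each step of the staircase.\<close>
  have fixp: "a \<squnion> (e \<sqinter> d) = d" if e: "e \<in> {b, c}" for e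
  proof (rule le_antisym)
    have ec: "e \<in> carrier K" using e b c by auto
    show "a \<squnion> (e \<sqinter> d) \<sqsubseteq> d"
      using a_d a d_carrier ec by (simp add: join_le_iff meet_right)
    let ?S' = "(\<lambda>x. a \<squnion> x) ` (\<lambda>x. e \<sqinter> x) ` ?S"
    have "countable_directed_glb K ?S' (a \<squnion> (e \<sqinter> d))"
      using S_glb a ec by (intro countable_directed_glb_join countable_directed_glb_meet)
    then have glb: "is_glb K (a \<squnion> (e \<sqinter> d)) ?S'" "?S' \<subseteq> carrier K"
      by (simp_all add: countable_directed_glb_def)
    \<comment> \<open>A further step by \<open>e\<close> leads from the value at \<open>t\<close> to
      the value at \<open>t @ [e]\<close>, so \<open>?S'\<close> stays inside the original
      family.\<close>
    have "d \<sqsubseteq> x" if x: "x \<in> ?S'" for x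
    proof -
      obtain t where t: "t \<in> ?T" "x = a \<squnion> (e \<sqinter> stair u a t)"
        using x by blast
      then have "x = stair u a (t @ [e])" "t @ [e] \<in> ?T"
        using e by (simp_all add: stair_simps)
      then show ?thesis using d_le by blast
    qed
    with glb(1)[unfolded is_glb_iff[OF glb(2)]] d_carrier show "d \<sqsubseteq> a \<squnion> (e \<sqinter> d)"
      by metis
    show "a \<squnion> (e \<sqinter> d) \<in> carrier K" "d \<in> carrier K"
      using a ec d_carrier by auto
  qed
  \<comment> \<open>Semidistributivity for \<open>b \<sqinter> d\<close> and
    \<open>c \<sqinter> d\<close>, whose joins with \<open>a\<close> are both
    \<open>d\<close>.\<close>
  have "a \<squnion> (b \<sqinter> d) = a \<squnion> ((b \<sqinter> d) \<sqinter> (c \<sqinter> d))"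
    using semidistributive a b c d_carrier fixp unfolding join_semidistributive_def
    by (metis insertCI meet_closed)
  moreover have "(b \<sqinter> d) \<sqinter> (c \<sqinter> d) = b \<sqinter> c"
    using b c d_carrier bc_d
    by (intro meet_eqI) (auto simp: le_meet_iff meet_left meet_right)
  ultimately have "d = a \<squnion> (b \<sqinter> c)"
    using fixp[of b] by simp
  with S_glb show ?thesis by simp
qed

section \<open>Alternating joins and meets preserve countable directed meets\<close>

definition zigzag :: "'a list \<Rightarrow> 'a \<Rightarrow> 'a" where
  "zigzag s x = foldl (\<lambda>y (n, a). if even n then a \<squnion> y else a \<sqinter> y) x (List.enumerate 0 s)"

lemma zigzag_simps:
  "zigzag [] x = x"
  "zigzag (s @ [a]) x = (if even (length s) then a \<squnion> zigzag s x else a \<sqinter> zigzag s x)"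
  by (simp_all add: zigzag_def enumerate_append_eq)

lemma countable_directed_glb_zigzag:
  assumes "countable_directed_glb K X m" "s \<in> lists (carrier K)"
  shows "countable_directed_glb K (zigzag s ` X) (zigzag s m)"
  using assms(2)
proof (induction s rule: rev_induct)
  case Nil
  then show ?case using assms by (simp add: zigzag_simps)
next
  case (snoc a s)
  then have IH: "countable_directed_glb K (zigzag s ` X) (zigzag s m)" and a: "a \<in> carrier K"
    by auto
  show ?case
    using countable_directed_glb_join[OF IH a] countable_directed_glb_meet[OF IH a]
    by (simp add: zigzag_simps image_image)
qed

section \<open>From an embedding to the axiom\<close>

text \<open>The meet formula holds in \<open>K\<close> for the images under \<open>f\<close>; it is
  pulled back to \<open>L\<close> with a new top by a map \<open>h\<close> that preserves all
  operations involved and reflects order between proper elements.\<close>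

lemma embeds_imp_SD_join_omega:
  assumes L: "lattice L" and f: "lattice_embedding L K f"
  shows "SD_join_omega L"
proof -
  interpret L: lattice L by (rule L)
  interpret L1: lattice "add_top L" by (rule L.lattice_add_top)
  have f_closed: "f x \<in> carrier K" if "x \<in> carrier L" for x
    using that f by (auto simp: lattice_embedding_def)
  have f_join: "f (x \<squnion>\<^bsub>L\<^esub> y) = f x \<squnion> f y" and f_meet: "f (x \<sqinter>\<^bsub>L\<^esub> y) = f x \<sqinter> f y"
    if "x \<in> carrier L" "y \<in> carrier L" for x y
    using that f by (auto simp: lattice_embedding_def join_pres_def meet_pres_def)
  have f_le: "f x \<sqsubseteq> f y \<longleftrightarrow> x \<sqsubseteq>\<^bsub>L\<^esub> y" if "x \<in> carrier L" "y \<in> carrier L" for x y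
  proof -
    have "f x \<sqsubseteq> f y \<longleftrightarrow> f (x \<squnion>\<^bsub>L\<^esub> y) = f y"
      using that by (simp add: f_closed f_join le_iff_meet)
    also have "\<dots> \<longleftrightarrow> x \<squnion>\<^bsub>L\<^esub> y = y"
      using f that by (auto simp: lattice_embedding_def inj_on_def)
    finally show ?thesis
      using that by (simp add: L.le_iff_meet)
  qed
  \<comment> \<open>The meet of the empty set is the largest element of \<open>K\<close>.\<close>
  obtain u where "is_glb K u {}"
    using meets unfolding countably_meet_complete_def by blast
  then have u: "u \<in> carrier K" "\<And>x. x \<in> carrier K \<Longrightarrow> x \<sqsubseteq> u"
    by (simp_all add: greatest_def)
  \<comment> \<open>\<open>f\<close> may itself attain \<open>u\<close>, so \<open>h\<close> need
    not be injective, and the value \<open>None\<close> has to be treated separately below. Still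
    \<open>u\<close> absorbs in joins and is neutral in meets, just as \<open>None\<close>
    is.\<close>
  define h where "h x = (case x of None \<Rightarrow> u | Some y \<Rightarrow> f y)" for x
  have h_simps [simp]: "h None = u" "h (Some y) = f y" for y
    by (simp_all add: h_def)
  have u_join: "x \<squnion> u = u" and u_meet: "x \<sqinter> u = x" if "x \<in> carrier K" for x
    using that u by (auto intro!: join_eqI meet_eqI)
  have h_join: "h (Some x \<squnion>\<^bsub>add_top L\<^esub> y) = f x \<squnion> h y"
    and h_meet: "h (Some x \<sqinter>\<^bsub>add_top L\<^esub> y) = f x \<sqinter> h y"
    if "x \<in> carrier L" "y \<in> carrier (add_top L)" for x y
    using that by (auto simp: f_join f_meet u_join u_meet f_closed)
  have h_star: "h (star L a t) = stair u (f a) (map f t)"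
    if a: "a \<in> carrier L" and t: "t \<in> lists (carrier L)" for a t
    using t
  proof (induction t rule: rev_induct)
    case (snoc b t)
    have "Some b \<sqinter>\<^bsub>add_top L\<^esub> star L a t \<in> carrier (add_top L)"
      using snoc.prems L.star_closed[OF a, of t] by (intro L1.meet_closed) auto
    with snoc a L.star_closed[OF a, of t] show ?case
      by (simp add: star_simps stair_simps h_join h_meet del: carrier_add_top)
  qed (simp add: star_simps stair_simps)
  have h_lozenge: "h (lozenge L s x) = zigzag (map f s) (h x)"
    if x: "x \<in> carrier (add_top L)" and s: "s \<in> lists (carrier L)" for s x
    using s
  proof (induction s rule: rev_induct)
    case (snoc b s)
    with x L.lozenge_closed[of s x] show ?case
      by (simp add: lozenge_simps zigzag_simps h_join h_meet del: carrier_add_top)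
  qed (simp add: lozenge_simps zigzag_simps)
  show ?thesis
    unfolding SD_join_omega_def
  proof (intro ballI)
    fix s a b c
    assume s: "s \<in> lists (carrier L)" and a: "a \<in> carrier L" and b: "b \<in> carrier L"
      and c: "c \<in> carrier L"
    let ?T = "lists {b, c}" and ?m = "lozenge L s (Some (a \<squnion>\<^bsub>L\<^esub> (b \<sqinter>\<^bsub>L\<^esub> c)))"
    let ?X = "{lozenge L s (star L a t) | t. t \<in> ?T}"
    have T: "t \<in> lists (carrier L)" if "t \<in> ?T" for t
      using that b c by (induction t) auto
    have fT: "map f ` ?T = lists {f b, f c}"
      using lists_image[of f "{b, c}"] by simp
    have "countable_directed_glb K (stair u (f a) ` lists {f b, f c}) (f a \<squnion> (f b \<sqinter> f c))"
      using a b c u by (intro stair_directed_glb f_closed)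
    then have "countable_directed_glb K (zigzag (map f s) ` stair u (f a) ` lists {f b, f c})
        (zigzag (map f s) (f a \<squnion> (f b \<sqinter> f c)))"
      using s by (intro countable_directed_glb_zigzag) (auto simp: f_closed)
    moreover have "zigzag (map f s) ` stair u (f a) ` lists {f b, f c} = h ` ?X"
    proof -
      have "zigzag (map f s) ` stair u (f a) ` lists {f b, f c} =
          (\<lambda>t. zigzag (map f s) (stair u (f a) (map f t))) ` ?T"
        by (simp only: fT[symmetric] image_image)
      also have "\<dots> = (\<lambda>t. h (lozenge L s (star L a t))) ` ?T"
        using h_lozenge[OF L.star_closed s] h_star a T by (intro image_cong) auto
      finally show ?thesis by (simp only: setcompr_eq_image image_image Collect_mem_eq)
    qed
    moreover have "zigzag (map f s) (f a \<squnion> (f b \<sqinter> f c)) = h ?m"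
      using a b c s by (simp add: h_lozenge f_join f_meet)
    ultimately have glb: "is_glb K (h ?m) (h ` ?X)" and hX: "h ` ?X \<subseteq> carrier K"
      by (simp_all add: countable_directed_glb_def)
    have X: "?X \<subseteq> carrier (add_top L)"
      using T L.lozenge_closed[OF s L.star_closed[OF a]] by (simp only: subset_iff mem_Collect_eq) metis
    obtain m where m: "?m = Some m" "m \<in> carrier L"
      using L.lozenge_Some[OF s, of "a \<squnion>\<^bsub>L\<^esub> (b \<sqinter>\<^bsub>L\<^esub> c)"] a b c by auto
    show "is_glb (add_top L) ?m ?X"
    proof (subst is_glb_iff[OF X], intro conjI ballI impI)
      show "?m \<in> carrier (add_top L)" using m by simp
    next
      fix x assume x: "x \<in> ?X"
      then have "h ?m \<sqsubseteq> h x"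
        using glb hX by (subst (asm) is_glb_iff) auto
      moreover have "x \<in> carrier (add_top L)" using X x by blast
      ultimately show "?m \<sqsubseteq>\<^bsub>add_top L\<^esub> x"
        using m by (auto simp: f_le)
    next
      fix y assume y: "y \<in> carrier (add_top L)" "\<forall>x\<in>?X. y \<sqsubseteq>\<^bsub>add_top L\<^esub> x"
      \<comment> \<open>A lower bound \<open>y\<close> could be \<open>None\<close> only if all
        members of \<open>?X\<close> were. The member for \<open>t = [b]\<close> is proper, because
        \<open>star L a [b]\<close> is \<open>a \<squnion> b\<close>.\<close>
      obtain e where e: "lozenge L s (Some (a \<squnion>\<^bsub>L\<^esub> b)) = Some e"
        using L.lozenge_Some[OF s, of "a \<squnion>\<^bsub>L\<^esub> b"] a b by auto
      have "star L a [b] = Some (a \<squnion>\<^bsub>L\<^esub> b)"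
        using a b star_simps(2)[of L a "[]" b] by (simp add: star_simps(1))
      then have "Some e = lozenge L s (star L a [b])" "[b] \<in> ?T"
        using e by simp_all
      then have "Some e \<in> ?X" by blast
      then have "y \<sqsubseteq>\<^bsub>add_top L\<^esub> Some e"
        using y(2) by (rule bspec[rotated])
      then have "y \<noteq> None" by (cases y) auto
      then obtain z where z: "y = Some z" "z \<in> carrier L"
        using y(1) by auto
      have "f z \<sqsubseteq> h x" if x: "x \<in> ?X" for x
      proof -
        have "y \<sqsubseteq>\<^bsub>add_top L\<^esub> x" "x \<in> carrier (add_top L)"
          using x y X by blast+
        then show ?thesis
          using z u by (auto simp: f_le f_closed)
      qed
      then have "f z \<sqsubseteq> h ?m"
        using glb hX z by (subst (asm) is_glb_iff) (auto simp: f_closed)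
      then show "y \<sqsubseteq>\<^bsub>add_top L\<^esub> ?m"
        using z m by (simp add: f_le)
    qed
  qed
qed

end


section \<open>The lattice of closed filters\<close>

text \<open>\<open>R P m\<close> is a closure rule: a filter that contains \<open>P\<close> has to
  contain \<open>m\<close>. The conditions \<open>rule_join\<close> and \<open>rule_meet\<close>
  make the closure a homomorphism, \<open>rule_stair\<close> gives semidistributivity, and
  \<open>rule_sound\<close> says that principal filters obey the rules. Inclusions suffice for
  \<open>P'\<close>, since a rule with fewer premises is stronger. The extra premise
  \<open>x\<close> in \<open>rule_meet\<close> accounts for meets of \<open>x\<close> with the new
  top.\<close>

locale meet_rules = lattice L for L :: "('a, 'm) gorder_scheme" (structure) +
  fixes R :: "'a set \<Rightarrow> 'a \<Rightarrow> bool"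
  assumes rule_carrier: "R P m \<Longrightarrow> P \<subseteq> carrier L \<and> m \<in> carrier L"
    and rule_join: "R P m \<Longrightarrow> x \<in> carrier L \<Longrightarrow> \<exists>P'. R P' (x \<squnion> m) \<and> P' \<subseteq> (\<lambda>p. x \<squnion> p) ` P"
    and rule_meet: "R P m \<Longrightarrow> x \<in> carrier L \<Longrightarrow>
      \<exists>P'. R P' (x \<sqinter> m) \<and> P' \<subseteq> insert x ((\<lambda>p. x \<sqinter> p) ` P)"
    and rule_stair: "a \<in> carrier L \<Longrightarrow> b \<in> carrier L \<Longrightarrow> c \<in> carrier L \<Longrightarrow> D \<subseteq> carrier L \<Longrightarrow>
      a \<squnion> b \<in> D \<Longrightarrow> a \<squnion> c \<in> D \<Longrightarrow>
      (\<And>y. y \<in> D \<Longrightarrow> a \<squnion> (b \<sqinter> y) \<in> D \<and> a \<squnion> (c \<sqinter> y) \<in> D) \<Longrightarrow> \<exists>P\<subseteq>D. R P (a \<squnion> (b \<sqinter> c))"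
    and rule_sound: "R P m \<Longrightarrow> x \<in> carrier L \<Longrightarrow> (\<And>p. p \<in> P \<Longrightarrow> x \<sqsubseteq> p) \<Longrightarrow> x \<sqsubseteq> m"
begin

section \<open>Filters and their closure under the rules\<close>

text \<open>Has at most one element. Forcing it into closed filters excludes the empty filter if
  \<open>L\<close> has a largest element; otherwise a one-element \<open>L\<close> could give a
  two-element \<open>K\<close>, outside its variety.\<close>

definition tops :: "'a set" where
  "tops = {x \<in> carrier L. \<forall>y\<in>carrier L. y \<sqsubseteq> x}"

definition is_filter :: "'a set \<Rightarrow> bool" where
  "is_filter F \<longleftrightarrow> F \<subseteq> carrier L \<and> (\<forall>x\<in>F. \<forall>y\<in>carrier L. x \<sqsubseteq> y \<longrightarrow> y \<in> F) \<and>
     (\<forall>x\<in>F. \<forall>y\<in>F. x \<sqinter> y \<in> F)"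

definition closed :: "'a set \<Rightarrow> bool" where
  "closed F \<longleftrightarrow> is_filter F \<and> tops \<subseteq> F \<and> (\<forall>P m. R P m \<longrightarrow> P \<subseteq> F \<longrightarrow> m \<in> F)"

text \<open>Binary meets are deliberately not among the generating rules: a join does not distribute
  over them, so the induction for \<open>cl_join\<close> would break. On filters they are recovered
  by \<open>cl_meet\<close>.\<close>

inductive_set cl :: "'a set \<Rightarrow> 'a set" for U where
  cl_base: "x \<in> U \<Longrightarrow> x \<in> carrier L \<Longrightarrow> x \<in> cl U"
| cl_top: "x \<in> tops \<Longrightarrow> x \<in> cl U"
| cl_up: "x \<in> cl U \<Longrightarrow> x \<sqsubseteq> y \<Longrightarrow> y \<in> carrier L \<Longrightarrow> y \<in> cl U"
| cl_rule: "R P m \<Longrightarrow> (\<And>p. p \<in> P \<Longrightarrow> p \<in> cl U) \<Longrightarrow> m \<in> cl U"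

lemma cl_carrier: "x \<in> cl U \<Longrightarrow> x \<in> carrier L"
  by (induction rule: cl.induct) (use rule_carrier in \<open>auto simp: tops_def\<close>)

lemma is_filterD:
  assumes "is_filter F"
  shows "x \<in> F \<Longrightarrow> x \<in> carrier L"
    and "x \<in> F \<Longrightarrow> x \<sqsubseteq> y \<Longrightarrow> y \<in> carrier L \<Longrightarrow> y \<in> F"
    and "x \<in> F \<Longrightarrow> y \<in> F \<Longrightarrow> x \<sqinter> y \<in> F"
  using assms unfolding is_filter_def by blast+

lemma closedD:
  assumes "closed F"
  shows "is_filter F"
    and "x \<in> tops \<Longrightarrow> x \<in> F"
    and "R P m \<Longrightarrow> P \<subseteq> F \<Longrightarrow> m \<in> F"
  using assms unfolding closed_def by blast+

lemma closedI:
  assumes "\<And>x. x \<in> F \<Longrightarrow> x \<in> carrier L"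
    and "\<And>x y. x \<in> F \<Longrightarrow> y \<in> carrier L \<Longrightarrow> x \<sqsubseteq> y \<Longrightarrow> y \<in> F"
    and "\<And>x y. x \<in> F \<Longrightarrow> y \<in> F \<Longrightarrow> x \<sqinter> y \<in> F"
    and "\<And>x. x \<in> tops \<Longrightarrow> x \<in> F"
    and "\<And>P m. R P m \<Longrightarrow> P \<subseteq> F \<Longrightarrow> m \<in> F"
  shows "closed F"
  unfolding closed_def is_filter_def
  by (intro conjI ballI allI impI subsetI; (rule assms; assumption))

lemmas closed_filterD = is_filterD[OF closedD(1)]

lemma cl_least:
  assumes "closed F" "U \<subseteq> F"
  shows "cl U \<subseteq> F"
proof
  fix x assume "x \<in> cl U"
  then show "x \<in> F"
    by (induction rule: cl.induct)
      (use assms in \<open>auto intro: closedD closed_filterD\<close>)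
qed

lemma cl_extensive: "is_filter U \<Longrightarrow> U \<subseteq> cl U"
  by (auto intro: cl_base is_filterD)

lemma cl_mono: "U \<subseteq> V \<Longrightarrow> x \<in> cl U \<Longrightarrow> x \<in> cl V"
  by (rotate_tac 1, induction rule: cl.induct) (auto intro: cl.intros)

lemma cl_closed: "closed F \<Longrightarrow> cl F = F"
  by (simp add: cl_extensive cl_least closedD(1) subset_antisym)

section \<open>The closure commutes with intersections of filters\<close>

text \<open>First of two nested inductions: \<open>x\<close> is still a generator, and
  \<open>rule_join\<close> moves the join with \<open>x\<close> through each rule used to derive
  \<open>y\<close>.\<close>

lemma cl_join_base:
  assumes "is_filter A" "is_filter B" "x \<in> A" "y \<in> cl B"
  shows "x \<squnion> y \<in> cl (A \<inter> B)"
  using assms(4)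
proof (induction rule: cl.induct)
  case (cl_base y)
  have "x \<in> carrier L" using assms(1,3) by (rule is_filterD)
  then have "x \<squnion> y \<in> A \<inter> B"
    using is_filterD(2)[OF assms(1), of x "x \<squnion> y"] is_filterD(2)[OF assms(2), of y "x \<squnion> y"]
      cl_base assms(3) by (simp add: join_left join_right)
  then show ?case using assms is_filterD by (auto intro: cl.cl_base)
next
  case (cl_top y)
  have x: "x \<in> carrier L" using assms(1,3) by (rule is_filterD)
  have "x \<squnion> y \<in> tops"
    using cl_top x unfolding tops_def by (auto intro: le_joinI2)
  then show ?case by (rule cl.cl_top)
next
  case (cl_up y z)
  have x: "x \<in> carrier L" using assms(1,3) by (rule is_filterD)
  have y: "y \<in> carrier L" using cl_up.hyps(1) by (rule cl_carrier)
  show ?case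
    using cl.cl_up[OF cl_up.IH, of "x \<squnion> z"] cl_up.hyps x y by (simp add: join_mono)
next
  case (cl_rule P m)
  have x: "x \<in> carrier L" using assms(1,3) by (rule is_filterD)
  obtain P' where P': "R P' (x \<squnion> m)" "P' \<subseteq> (\<lambda>p. x \<squnion> p) ` P"
    using rule_join[OF cl_rule.hyps(1) x] by blast
  show ?case
    by (rule cl.cl_rule[OF P'(1)]) (use P'(2) cl_rule.IH in blast)
qed

text \<open>Second induction, now on \<open>x\<close>, with an arbitrary \<open>y\<close> of the
  other closure kept fixed; the first one supplies the base case.\<close>

lemma cl_join:
  assumes "is_filter A" "is_filter B" "x \<in> cl A" "y \<in> cl B"
  shows "x \<squnion> y \<in> cl (A \<inter> B)"
  using assms(3)
proof (induction rule: cl.induct)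
  case (cl_base x)
  then show ?case using cl_join_base assms by blast
next
  case (cl_top x)
  have y: "y \<in> carrier L" using assms(4) by (rule cl_carrier)
  have "x \<squnion> y \<in> tops"
    using cl_top y unfolding tops_def by (auto intro: le_joinI1)
  then show ?case by (rule cl.cl_top)
next
  case (cl_up x z)
  have y: "y \<in> carrier L" using assms(4) by (rule cl_carrier)
  have x: "x \<in> carrier L" using cl_up.hyps(1) by (rule cl_carrier)
  show ?case
    using cl.cl_up[OF cl_up.IH, of "z \<squnion> y"] cl_up.hyps x y by (simp add: join_mono)
next
  case (cl_rule P m)
  have y: "y \<in> carrier L" using assms(4) by (rule cl_carrier)
  obtain P' where P': "R P' (y \<squnion> m)" "P' \<subseteq> (\<lambda>p. y \<squnion> p) ` P"
    using rule_join[OF cl_rule.hyps(1) y] by blast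
  have "y \<squnion> m \<in> cl (A \<inter> B)"
    by (rule cl.cl_rule[OF P'(1)]) (use P'(2) cl_rule.IH in \<open>auto simp: join_comm[of L y]\<close>)
  then show ?case by (simp add: join_comm)
qed

text \<open>Same two-stage scheme for meets. The extra premise \<open>x\<close> of
  \<open>rule_meet\<close> is available because \<open>x\<close> belongs to
  \<open>U\<close>.\<close>

lemma cl_meet_base:
  assumes "is_filter U" "x \<in> U" "y \<in> cl U"
  shows "x \<sqinter> y \<in> cl U"
  using assms(3)
proof (induction rule: cl.induct)
  case (cl_base y)
  then have "x \<sqinter> y \<in> U"
    using assms(1,2) by (simp add: is_filterD(3))
  then show ?case
    using is_filterD(1)[OF assms(1)] by (simp add: cl.cl_base)
next
  case (cl_top y)
  have x: "x \<in> carrier L" using assms(1,2) by (rule is_filterD)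
  then have "x \<sqinter> y = x"
    using cl_top unfolding tops_def by (intro meet_eqI) auto
  then show ?case using assms x by (simp add: cl.cl_base)
next
  case (cl_up y z)
  have x: "x \<in> carrier L" using assms(1,2) by (rule is_filterD)
  have y: "y \<in> carrier L" using cl_up.hyps(1) by (rule cl_carrier)
  show ?case
    using cl.cl_up[OF cl_up.IH, of "x \<sqinter> z"] cl_up.hyps x y by (simp add: meet_mono)
next
  case (cl_rule P m)
  have x: "x \<in> carrier L" using assms(1,2) by (rule is_filterD)
  obtain P' where P': "R P' (x \<sqinter> m)" "P' \<subseteq> insert x ((\<lambda>p. x \<sqinter> p) ` P)"
    using rule_meet[OF cl_rule.hyps(1) x] by blast
  show ?case
    by (rule cl.cl_rule[OF P'(1)]) (use P'(2) cl_rule.IH assms(2) x cl.cl_base in blast)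
qed

lemma cl_meet:
  assumes "is_filter U" "x \<in> cl U" "y \<in> cl U"
  shows "x \<sqinter> y \<in> cl U"
  using assms(2)
proof (induction rule: cl.induct)
  case (cl_base x)
  then show ?case using cl_meet_base assms by blast
next
  case (cl_top x)
  have y: "y \<in> carrier L" using assms(3) by (rule cl_carrier)
  then have "x \<sqinter> y = y"
    using cl_top unfolding tops_def by (intro meet_eqI) auto
  then show ?case using assms by simp
next
  case (cl_up x z)
  have y: "y \<in> carrier L" using assms(3) by (rule cl_carrier)
  have x: "x \<in> carrier L" using cl_up.hyps(1) by (rule cl_carrier)
  show ?case
    using cl.cl_up[OF cl_up.IH, of "z \<sqinter> y"] cl_up.hyps x y by (simp add: meet_mono)
next
  case (cl_rule P m)
  have y: "y \<in> carrier L" using assms(3) by (rule cl_carrier)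
  obtain P' where P': "R P' (y \<sqinter> m)" "P' \<subseteq> insert y ((\<lambda>p. y \<sqinter> p) ` P)"
    using rule_meet[OF cl_rule.hyps(1) y] by blast
  have "y \<sqinter> m \<in> cl U"
    by (rule cl.cl_rule[OF P'(1)])
      (use P'(2) cl_rule.IH assms(3) in \<open>auto simp: meet_comm[of L y]\<close>)
  then show ?case by (simp add: meet_comm)
qed

lemma closed_cl:
  assumes "is_filter U"
  shows "closed (cl U)"
  by (rule closedI) (blast intro: cl_carrier cl_up cl_top cl_rule cl_meet[OF assms])+

text \<open>A common element of both closures is its own join, so \<open>cl_join\<close> applies to
  it twice over.\<close>

lemma cl_Int:
  assumes "is_filter A" "is_filter B"
  shows "cl A \<inter> cl B = cl (A \<inter> B)"
proof
  show "cl A \<inter> cl B \<subseteq> cl (A \<inter> B)"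
  proof
    fix x assume x: "x \<in> cl A \<inter> cl B"
    then have "x \<in> carrier L" using cl_carrier by blast
    then have "x \<squnion> x = x" by (intro join_eqI) auto
    then show "x \<in> cl (A \<inter> B)"
      using cl_join[OF assms, of x x] x by simp
  qed
  show "cl (A \<inter> B) \<subseteq> cl A \<inter> cl B"
    using cl_mono[of "A \<inter> B" A] cl_mono[of "A \<inter> B" B] by blast
qed

text \<open>The factor \<open>carrier L\<close> gives the intersection of the empty family its
  proper value.\<close>

lemma closed_carrier_Inter:
  assumes "\<And>F. F \<in> X \<Longrightarrow> closed F"
  shows "closed (carrier L \<inter> \<Inter>X)"
proof (rule closedI)
  fix P m assume "R P m" "P \<subseteq> carrier L \<inter> \<Inter>X"
  then show "m \<in> carrier L \<inter> \<Inter>X"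
    using assms rule_carrier by (blast intro: closedD(3))
next
  fix x assume "x \<in> tops"
  then show "x \<in> carrier L \<inter> \<Inter>X"
    using assms closedD(2) by (auto simp: tops_def)
next
  fix x y assume "x \<in> carrier L \<inter> \<Inter>X" "y \<in> carrier L \<inter> \<Inter>X"
  then show "x \<sqinter> y \<in> carrier L \<inter> \<Inter>X"
    using assms by (auto intro!: closed_filterD(3))
qed (use assms in \<open>blast intro: closed_filterD\<close>)+

lemma closed_Int:
  assumes "closed A" "closed B"
  shows "closed (A \<inter> B)"
proof (rule closedI)
  fix P m assume "R P m" "P \<subseteq> A \<inter> B"
  then show "m \<in> A \<inter> B"
    using assms by (blast intro: closedD(3))
qed (use assms in \<open>blast intro: closedD(2) closed_filterD\<close>)+

section \<open>The filter generated by two filters\<close>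

text \<open>\<open>A\<close> and \<open>B\<close> are listed separately because filters may be
  empty: if one is, there are no meets \<open>a \<sqinter> b\<close>, and the result must be the
  other.\<close>

definition filter_sup :: "'a set \<Rightarrow> 'a set \<Rightarrow> 'a set" where
  "filter_sup A B = A \<union> B \<union> {x \<in> carrier L. \<exists>a\<in>A. \<exists>b\<in>B. a \<sqinter> b \<sqsubseteq> x}"

lemma is_filter_sup:
  assumes A: "is_filter A" and B: "is_filter B"
  shows "is_filter (filter_sup A B)"
proof -
  have mem: "x \<sqinter> y \<in> filter_sup A B"
    if xy: "x \<in> filter_sup A B" "y \<in> filter_sup A B" for x y
  proof (cases "A = {} \<or> B = {}")
    case True
    then show ?thesis
      using xy is_filterD(3)[OF A] is_filterD(3)[OF B] by (auto simp: filter_sup_def)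
  next
    case False
    have *: "\<exists>a\<in>A. \<exists>b\<in>B. a \<sqinter> b \<sqsubseteq> z" "z \<in> carrier L" if z: "z \<in> filter_sup A B" for z
      using z False A B is_filterD(1)[OF A] is_filterD(1)[OF B]
      unfolding filter_sup_def by (blast intro: meet_left meet_right)+
    obtain a b a' b' where "a \<in> A" "b \<in> B" "a \<sqinter> b \<sqsubseteq> x" "a' \<in> A" "b' \<in> B" "a' \<sqinter> b' \<sqsubseteq> y"
      using *(1)[OF xy(1)] *(1)[OF xy(2)] by blast
    note ab = this
    note carr = is_filterD(1)[OF A ab(1)] is_filterD(1)[OF B ab(2)]
      is_filterD(1)[OF A ab(4)] is_filterD(1)[OF B ab(5)] *(2)[OF xy(1)] *(2)[OF xy(2)]
    let ?z = "(a \<sqinter> a') \<sqinter> (b \<sqinter> b')"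
    have "?z \<sqsubseteq> a \<sqinter> b" "?z \<sqsubseteq> a' \<sqinter> b'"
      using carr by (auto intro!: meet_mono meet_left meet_right)
    then have "?z \<sqsubseteq> x" "?z \<sqsubseteq> y"
      using le_trans[OF _ ab(3)] le_trans[OF _ ab(6)] carr by simp_all
    then have "?z \<sqsubseteq> x \<sqinter> y"
      using carr by (intro meet_le) simp_all
    moreover have "a \<sqinter> a' \<in> A" "b \<sqinter> b' \<in> B"
      using ab A B by (auto intro: is_filterD)
    ultimately show ?thesis
      using carr by (auto simp: filter_sup_def)
  qed
  have up: "y \<in> filter_sup A B" if xy: "x \<in> filter_sup A B" "x \<sqsubseteq> y" "y \<in> carrier L" for x y
  proof -
    consider "x \<in> A" | "x \<in> B" | a b where "x \<in> carrier L" "a \<in> A" "b \<in> B" "a \<sqinter> b \<sqsubseteq> x"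
      using xy(1) unfolding filter_sup_def by blast
    then show ?thesis
    proof cases
      case 1
      then show ?thesis using xy is_filterD(2)[OF A] by (simp add: filter_sup_def)
    next
      case 2
      then show ?thesis using xy is_filterD(2)[OF B] by (simp add: filter_sup_def)
    next
      case 3
      then have "a \<sqinter> b \<sqsubseteq> y"
        using le_trans[OF 3(4) xy(2)] xy(3) is_filterD(1)[OF A] is_filterD(1)[OF B] by simp
      then show ?thesis using 3 xy(3) by (auto simp: filter_sup_def)
    qed
  qed
  have "filter_sup A B \<subseteq> carrier L"
    using is_filterD(1)[OF A] is_filterD(1)[OF B] by (auto simp: filter_sup_def)
  then show ?thesis
    unfolding is_filter_def using up mem by blast
qed

lemma filter_sup_least:
  assumes "is_filter F" "A \<subseteq> F" "B \<subseteq> F"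
  shows "filter_sup A B \<subseteq> F"
  using assms unfolding filter_sup_def is_filter_def by blast

section \<open>The lattice of closed filters under reverse inclusion\<close>

definition K :: "'a set gorder" where
  "K = \<lparr>carrier = {F. closed F}, eq = (=), le = (\<lambda>F G. G \<subseteq> F)\<rparr>"

lemma K_simps [simp]: "carrier K = {F. closed F}" "F \<sqsubseteq>\<^bsub>K\<^esub> G \<longleftrightarrow> G \<subseteq> F"
  by (simp_all add: K_def)

lemma complete_lattice_K: "complete_lattice K"
proof -
  interpret K: partial_order K
    by unfold_locales (auto simp: K_def)
  show ?thesis
  proof (rule K.complete_latticeI)
    fix X assume X: "X \<subseteq> carrier K"
    have "is_lub K (carrier L \<inter> \<Inter>X) X"
      using X by (subst is_lub_iff[OF X])
        (auto simp: subset_iff intro!: closed_carrier_Inter intro: closed_filterD)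
    then show "\<exists>s. is_lub K s X" ..
    \<comment> \<open>\<open>\<Union>X\<close> need not be a filter, and \<open>cl\<close> is known
      to produce closed filters only from filters; hence the meet is taken as an
      intersection.\<close>
    have "is_glb K (carrier L \<inter> \<Inter>{F. closed F \<and> \<Union>X \<subseteq> F}) X"
      using X by (subst is_glb_iff[OF X], intro conjI)
        (auto simp: subset_iff intro!: closed_carrier_Inter intro: closed_filterD)
    then show "\<exists>s. is_glb K s X" ..
  qed
qed

interpretation K: complete_lattice K
  by (rule complete_lattice_K)

lemma join_K: "closed A \<Longrightarrow> closed B \<Longrightarrow> A \<squnion>\<^bsub>K\<^esub> B = A \<inter> B"
  by (rule K.join_eqI) (auto simp: closed_Int)

lemma meet_K:
  assumes "closed A" "closed B"
  shows "A \<sqinter>\<^bsub>K\<^esub> B = cl (filter_sup A B)"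
proof -
  note fil = is_filter_sup[OF closedD(1)[OF assms(1)] closedD(1)[OF assms(2)]]
  have "A \<subseteq> cl (filter_sup A B)" "B \<subseteq> cl (filter_sup A B)"
    using cl_extensive[OF fil] by (auto simp: filter_sup_def)
  then show ?thesis
    using assms closed_cl[OF fil] cl_least filter_sup_least closedD(1)
    by (intro K.meet_eqI) auto
qed

lemma join_semidistributive_K: "join_semidistributive K"
  unfolding join_semidistributive_def
proof (intro ballI impI)
  fix A B C
  assume "A \<in> carrier K" "B \<in> carrier K" "C \<in> carrier K" and eq: "A \<squnion>\<^bsub>K\<^esub> B = A \<squnion>\<^bsub>K\<^esub> C"
  then have A: "closed A" and B: "closed B" and C: "closed C"
    by auto
  note fA = closed_filterD[OF A] and fB = closed_filterD[OF B] and fC = closed_filterD[OF C]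
  define D where "D = A \<inter> B"
  have AC: "A \<inter> C = D" and D: "closed D"
    using eq A B C by (auto simp: join_K D_def closed_Int)
  have fil: "is_filter (filter_sup B C)"
    using B C by (intro is_filter_sup closedD)
  \<comment> \<open>By \<open>cl_Int\<close>, intersecting with \<open>A\<close> commutes with the
    closure, so it is enough to treat the filter join before closing it.\<close>
  have "A \<inter> filter_sup B C \<subseteq> D"
  proof
    fix x assume x: "x \<in> A \<inter> filter_sup B C"
    then have xc: "x \<in> carrier L" using fA by blast
    consider "x \<in> B \<union> C" | b c where "b \<in> B" "c \<in> C" "b \<sqinter> c \<sqsubseteq> x"
      using x unfolding filter_sup_def by blast
    then show "x \<in> D"
    proof cases
      case 1
      then show ?thesis using x AC by (auto simp: D_def)
    next
      case 2
      have bc: "b \<in> carrier L" "c \<in> carrier L"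
        using 2 fB fC by auto
      have inA: "x \<squnion> y \<in> A" if "y \<in> carrier L" for y
        using x xc that fA(2)[of x "x \<squnion> y"] by (simp add: join_left)
      have inB: "x \<squnion> y \<in> B" if "y \<in> B" for y
        using xc that fB(1)[of y] fB(2)[of y "x \<squnion> y"] by (simp add: join_right)
      have inC: "x \<squnion> y \<in> C" if "y \<in> C" for y
        using xc that fC(1)[of y] fC(2)[of y "x \<squnion> y"] by (simp add: join_right)
      \<comment> \<open>Everything above \<open>x\<close> is in \<open>A\<close>, while joins with
        elements of \<open>B\<close> or \<open>C\<close> remain there; so \<open>D\<close> contains
        each step of the staircase from \<open>x\<close> with entries \<open>b\<close> and
        \<open>c\<close>.\<close>
      have "\<exists>P\<subseteq>D. R P (x \<squnion> (b \<sqinter> c))"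
      proof (rule rule_stair)
        show "D \<subseteq> carrier L" using D closed_filterD by blast
        show "x \<squnion> b \<in> D" using inA inB 2 bc by (simp add: D_def)
        show "x \<squnion> c \<in> D" using inA inC 2 bc by (simp flip: AC)
        fix y assume y: "y \<in> D"
        then have yB: "y \<in> B" and yC: "y \<in> C" and yc: "y \<in> carrier L"
          using AC fB by (auto simp: D_def)
        have "x \<squnion> (b \<sqinter> y) \<in> A \<inter> B"
          using inA inB 2 bc yc fB(3)[OF _ yB] by simp
        moreover have "x \<squnion> (c \<sqinter> y) \<in> A \<inter> C"
          using inA inC 2 bc yc fC(3)[OF _ yC] by simp
        ultimately show "x \<squnion> (b \<sqinter> y) \<in> D \<and> x \<squnion> (c \<sqinter> y) \<in> D"
          using AC by (simp add: D_def)
      qed (use xc bc in auto)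
      then have "x \<squnion> (b \<sqinter> c) \<in> D"
        using closedD(3)[OF D] by blast
      moreover have "x \<squnion> (b \<sqinter> c) = x"
        using xc bc 2 by (intro join_eqI) auto
      ultimately show ?thesis by simp
    qed
  qed
  then have "cl (A \<inter> filter_sup B C) \<subseteq> D"
    by (rule cl_least[OF D])
  then have "A \<inter> cl (filter_sup B C) \<subseteq> D"
    using cl_Int[OF closedD(1)[OF A] fil] cl_closed[OF A] by simp
  moreover have "D \<subseteq> A \<inter> cl (filter_sup B C)"
    using cl_extensive[OF fil] by (auto simp: D_def filter_sup_def)
  ultimately show "A \<squnion>\<^bsub>K\<^esub> B = A \<squnion>\<^bsub>K\<^esub> (B \<sqinter>\<^bsub>K\<^esub> C)"
    using A B C closed_cl[OF fil] by (simp add: meet_K join_K D_def) blast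
qed

text \<open>A family directed downwards in \<open>K\<close> is directed upwards for inclusion, so
  its union is a filter whose closure is the meet. Intersection distributes over the union, and
  \<open>cl_Int\<close> carries this over to the closures.\<close>

lemma lower_continuous_K: "lower_continuous K"
  unfolding lower_continuous_def
proof (intro ballI allI impI)
  fix A X M
  assume "A \<in> carrier K" and X: "X \<subseteq> carrier K" and dir: "down_directed K X"
    and glb: "is_glb K M X"
  then have A: "closed A" and closed_X: "\<And>F. F \<in> X \<Longrightarrow> closed F"
    by auto
  have fil: "is_filter (\<Union>X)"
    unfolding is_filter_def
  proof (intro conjI ballI impI)
    show "\<Union>X \<subseteq> carrier L" using closed_X closed_filterD(1) by blast
    show "y \<in> \<Union>X" if "x \<in> \<Union>X" "y \<in> carrier L" "x \<sqsubseteq> y" for x y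
      using that closed_X closed_filterD(2) by blast
    fix x y assume "x \<in> \<Union>X" "y \<in> \<Union>X"
    then obtain F where "F \<in> X" "x \<in> F" "y \<in> F"
      using dir unfolding down_directed_def K_simps by blast
    then show "x \<sqinter> y \<in> \<Union>X"
      using closed_X closed_filterD(3) by blast
  qed
  have M: "closed M" "\<And>F. F \<in> X \<Longrightarrow> F \<subseteq> M"
    "\<And>G. closed G \<Longrightarrow> (\<And>F. F \<in> X \<Longrightarrow> F \<subseteq> G) \<Longrightarrow> M \<subseteq> G"
    using glb by (auto simp: is_glb_iff[OF X])
  have "M = cl (\<Union>X)"
  proof
    show "cl (\<Union>X) \<subseteq> M"
      using M by (intro cl_least) blast+
    show "M \<subseteq> cl (\<Union>X)"
      using cl_extensive[OF fil] by (intro M closed_cl[OF fil]) blast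
  qed
  then have AM: "A \<inter> M = cl (A \<inter> \<Union>X)"
    using cl_Int[OF closedD(1)[OF A] fil] cl_closed[OF A] by simp
  have img: "{A \<squnion>\<^bsub>K\<^esub> F | F. F \<in> X} = (\<inter>) A ` X"
    unfolding setcompr_eq_image Collect_mem_eq using A closed_X
    by (intro image_cong) (auto simp: join_K)
  show "is_glb K (A \<squnion>\<^bsub>K\<^esub> M) {A \<squnion>\<^bsub>K\<^esub> F | F. F \<in> X}"
    unfolding img join_K[OF A M(1)]
  proof (subst is_glb_iff, use A closed_X closed_Int in force, intro conjI ballI impI)
    show "A \<inter> M \<in> carrier K"
      using A M(1) by (simp add: closed_Int)
    show "A \<inter> M \<sqsubseteq>\<^bsub>K\<^esub> G" if "G \<in> (\<inter>) A ` X" for G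
      using that M(2) by auto
    fix G assume "G \<in> carrier K" "\<forall>H\<in>(\<inter>) A ` X. G \<sqsubseteq>\<^bsub>K\<^esub> H"
    then have "closed G" "A \<inter> \<Union>X \<subseteq> G"
      by auto
    then show "G \<sqsubseteq>\<^bsub>K\<^esub> A \<inter> M"
      unfolding AM by (simp add: cl_least)
  qed
qed

section \<open>The embedding by principal filters\<close>

definition principal :: "'a \<Rightarrow> 'a set" where
  "principal x = {y \<in> carrier L. x \<sqsubseteq> y}"

lemma closed_principal:
  assumes "x \<in> carrier L"
  shows "closed (principal x)"
proof (rule closedI)
  fix P m assume P: "R P m" "P \<subseteq> principal x"
  then have "x \<sqsubseteq> m"
    using assms by (rule_tac rule_sound[OF P(1)]) (auto simp: principal_def)
  then show "m \<in> principal x"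
    using rule_carrier[OF P(1)] by (simp add: principal_def)
next
  fix y z assume "y \<in> principal x" "z \<in> carrier L" "y \<sqsubseteq> z"
  then show "z \<in> principal x"
    using assms le_trans[of x y z] by (simp add: principal_def)
qed (use assms in \<open>auto simp: principal_def tops_def le_meet_iff\<close>)

lemma principal_join:
  assumes "x \<in> carrier L" "y \<in> carrier L"
  shows "principal (x \<squnion> y) = principal x \<squnion>\<^bsub>K\<^esub> principal y"
  using assms by (subst join_K) (simp_all add: closed_principal, auto simp: principal_def join_le_iff)

lemma principal_subset_iff:
  assumes "x \<in> carrier L" "is_filter F"
  shows "principal x \<subseteq> F \<longleftrightarrow> x \<in> F"
  using assms(1) is_filterD(2)[OF assms(2)] by (auto simp: principal_def subset_iff)

text \<open>The closure in \<open>meet_K\<close> is avoided by the universal property: a closed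
  filter containing \<open>x\<close> and \<open>y\<close> contains
  \<open>x \<sqinter> y\<close>.\<close>

lemma principal_meet:
  assumes "x \<in> carrier L" "y \<in> carrier L"
  shows "principal (x \<sqinter> y) = principal x \<sqinter>\<^bsub>K\<^esub> principal y"
  using assms closedD(1) closed_filterD(3)
  by (intro K.meet_eqI[symmetric])
    (auto simp: closed_principal principal_subset_iff, auto simp: principal_def meet_leI1 meet_leI2)

lemma lattice_embedding_principal: "lattice_embedding L K principal"
proof -
  have "x = y" if "x \<in> carrier L" "y \<in> carrier L" "principal x = principal y" for x y
    using that by (auto simp: principal_def intro!: le_antisym)
  then show ?thesis
    using lattice_axioms K.lattice_axioms unfolding lattice_embedding_def
    by (auto simp: closed_principal join_pres_def meet_pres_def principal_join principal_meet
        intro!: inj_onI)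
qed

text \<open>An upper bound in \<open>K\<close> of the images is a filter consisting of upper bounds
  of \<open>X\<close>, all of which lie above the join \<open>x\<close>.\<close>

lemma join_complete_principal: "join_complete L K principal"
  unfolding join_complete_def
proof (intro allI impI)
  fix x X
  assume X: "X \<subseteq> carrier L" and lub: "is_lub L x X"
  have x: "x \<in> carrier L" "\<And>y. y \<in> X \<Longrightarrow> y \<sqsubseteq> x"
    "\<And>z. z \<in> carrier L \<Longrightarrow> (\<And>y. y \<in> X \<Longrightarrow> y \<sqsubseteq> z) \<Longrightarrow> x \<sqsubseteq> z"
    using lub by (auto simp: is_lub_iff[OF X])
  have pX: "principal ` X \<subseteq> carrier K"
    using X by (auto simp: closed_principal)
  show "is_lub K (principal x) (principal ` X)"
  proof (subst is_lub_iff[OF pX], intro conjI ballI impI)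
    show "principal x \<in> carrier K" using x by (simp add: closed_principal)
    show "F \<sqsubseteq>\<^bsub>K\<^esub> principal x" if F: "F \<in> principal ` X" for F
    proof -
      obtain y where y: "y \<in> X" "F = principal y" using F by blast
      then have "y \<in> carrier L" "y \<sqsubseteq> x" using X x by auto
      then show ?thesis
        using x(1) le_trans[of y x] by (auto simp: y(2) principal_def)
    qed
    fix G assume "G \<in> carrier K" "\<forall>F\<in>principal ` X. F \<sqsubseteq>\<^bsub>K\<^esub> G"
    then show "principal x \<sqsubseteq>\<^bsub>K\<^esub> G"
      using x(3) closed_filterD(1)[of G] by (auto simp: principal_def subset_iff)
  qed
qed

end


section \<open>Identities\<close>

context lattice
begin

lemma lterm_val_Some:
  assumes "range v \<subseteq> carrier L"
  shows "lterm_val (add_top L) (\<lambda>i. Some (v i)) p = Some (lterm_val L v p)"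
  by (induction p) (simp_all add: lterm_val_closed[OF assms])

text \<open>The new top behaves like any sufficiently large \<open>u\<close> of \<open>L\<close>:
  replacing \<open>None\<close> by \<open>u\<close> commutes with evaluation. The bound by
  \<open>u\<close> is part of the induction, as it turns a join with \<open>u\<close> into
  \<open>u\<close> and makes \<open>u\<close> neutral in meets.\<close>

lemma lterm_val_large:
  assumes "z \<in> carrier L" and w: "range w \<subseteq> carrier (add_top L)"
  shows "\<exists>u0\<in>carrier L. \<forall>u\<in>carrier L. u0 \<sqsubseteq> u \<longrightarrow>
    lterm_val L (\<lambda>i. case_option u id (w i)) p = case_option u id (lterm_val (add_top L) w p) \<and>
    case_option u id (lterm_val (add_top L) w p) \<sqsubseteq> u" (is "\<exists>u0\<in>_. \<forall>u\<in>_. _ \<longrightarrow> ?P u p")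
proof (induction p)
  case (LVar n)
  have "w n \<in> carrier (add_top L)" using w by blast
  then show ?case
    using assms(1) by (cases "w n") auto
next
  case (LJoin p q)
  obtain u0 u1 where u: "u0 \<in> carrier L" "\<And>u. u \<in> carrier L \<Longrightarrow> u0 \<sqsubseteq> u \<Longrightarrow> ?P u p"
    "u1 \<in> carrier L" "\<And>u. u \<in> carrier L \<Longrightarrow> u1 \<sqsubseteq> u \<Longrightarrow> ?P u q"
    using LJoin by blast
  interpret L1: lattice "add_top L" by (rule lattice_add_top)
  have closed: "lterm_val (add_top L) w p \<in> carrier (add_top L)"
    "lterm_val (add_top L) w q \<in> carrier (add_top L)"
    using w by (rule L1.lterm_val_closed)+
  have "?P u (LJoin p q)" if "u \<in> carrier L" "u0 \<squnion> u1 \<sqsubseteq> u" for u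
  proof -
    have "u0 \<sqsubseteq> u" "u1 \<sqsubseteq> u" using u(1,3) that by (simp_all add: join_le_iff)
    then have "?P u p" "?P u q" using u(2,4) that(1) by blast+
    then show ?thesis
      using closed that(1) by (auto split: option.splits simp: join_le_iff join_left join_right intro!: join_eqI)
  qed
  then show ?case using u(1,3) by (intro bexI[of _ "u0 \<squnion> u1"]) auto
next
  case (LMeet p q)
  obtain u0 u1 where u: "u0 \<in> carrier L" "\<And>u. u \<in> carrier L \<Longrightarrow> u0 \<sqsubseteq> u \<Longrightarrow> ?P u p"
    "u1 \<in> carrier L" "\<And>u. u \<in> carrier L \<Longrightarrow> u1 \<sqsubseteq> u \<Longrightarrow> ?P u q"
    using LMeet by blast
  interpret L1: lattice "add_top L" by (rule lattice_add_top)
  have closed: "lterm_val (add_top L) w p \<in> carrier (add_top L)"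
    "lterm_val (add_top L) w q \<in> carrier (add_top L)"
    using w by (rule L1.lterm_val_closed)+
  have meet_u: "x \<sqinter> u = x" "u \<sqinter> x = x" if "x \<in> carrier L" "u \<in> carrier L" "x \<sqsubseteq> u" for x u
    using that le_iff_join[of x u] meet_comm[of L u x] by simp_all
  have "?P u (LMeet p q)" if "u \<in> carrier L" "u0 \<squnion> u1 \<sqsubseteq> u" for u
  proof -
    have "u0 \<sqsubseteq> u" "u1 \<sqsubseteq> u" using u(1,3) that by (simp_all add: join_le_iff)
    then have "?P u p" "?P u q" using u(2,4) that(1) by blast+
    then show ?thesis
      using closed that(1)
      by (auto split: option.splits simp: meet_leI1 meet_u)
  qed
  then show ?case using u(1,3) by (intro bexI[of _ "u0 \<squnion> u1"]) auto
qed

text \<open>Replace \<open>None\<close> by large \<open>u\<close>. If just one side of the identity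
  were \<open>None\<close>, the other being \<open>x\<close>, then all large \<open>u\<close> would
  equal \<open>x\<close>, which is impossible without a largest element.\<close>

lemma identity_add_top:
  assumes identity: "\<And>v. range v \<subseteq> carrier L \<Longrightarrow> lterm_val L v p = lterm_val L v q"
    and w: "range w \<subseteq> carrier (add_top L)"
    and no_top: "None \<notin> range w \<or> (\<forall>x\<in>carrier L. \<exists>y\<in>carrier L. \<not> y \<sqsubseteq> x)"
  shows "lterm_val (add_top L) w p = lterm_val (add_top L) w q"
proof (cases "None \<in> range w")
  case False
  then have w': "w i \<noteq> None" "w i \<in> carrier (add_top L)" for i
    using w by (metis rangeI, blast)
  then have "the (w i) \<in> carrier L" for i
    using w'[of i] by (cases "w i") auto
  then have "range (\<lambda>i. the (w i)) \<subseteq> carrier L" by blast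
  moreover have "w = (\<lambda>i. Some (the (w i)))"
    using w' by simp
  ultimately show ?thesis
    using identity lterm_val_Some by metis
next
  case True
  interpret L1: lattice "add_top L" by (rule lattice_add_top)
  note unbounded = no_top[simplified True simp_thms]
  show ?thesis
  proof (cases "carrier L = {}")
    case True
    then show ?thesis
      using L1.lterm_val_closed[OF w, of p] L1.lterm_val_closed[OF w, of q] by simp
  next
    case False
    then obtain z where z: "z \<in> carrier L" by blast
    obtain u0 where u0: "u0 \<in> carrier L" "\<And>u. u \<in> carrier L \<Longrightarrow> u0 \<sqsubseteq> u \<Longrightarrow>
        lterm_val L (\<lambda>i. case_option u id (w i)) p = case_option u id (lterm_val (add_top L) w p)"
      using lterm_val_large[OF z w, of p] by blast
    obtain u1 where u1: "u1 \<in> carrier L" "\<And>u. u \<in> carrier L \<Longrightarrow> u1 \<sqsubseteq> u \<Longrightarrow>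
        lterm_val L (\<lambda>i. case_option u id (w i)) q = case_option u id (lterm_val (add_top L) w q)"
      using lterm_val_large[OF z w, of q] by blast
    have eq: "case_option u id (lterm_val (add_top L) w p) = case_option u id (lterm_val (add_top L) w q)"
      if u: "u \<in> carrier L" "u0 \<squnion> u1 \<sqsubseteq> u" for u
    proof -
      have "case_option u id (w i) \<in> carrier L" for i
      proof -
        have "w i \<in> carrier (add_top L)" using w by blast
        then show ?thesis using u(1) by auto
      qed
      then have "range (\<lambda>i. case_option u id (w i)) \<subseteq> carrier L"
        by blast
      then show ?thesis
        using identity u u0 u1 by (metis join_le_iff)
    qed
    \<comment> \<open>Joining with an element not below \<open>x\<close> yields a large
      \<open>u\<close> different from \<open>x\<close>.\<close>
    have "\<exists>u\<in>carrier L. u0 \<squnion> u1 \<sqsubseteq> u \<and> u \<noteq> x" if x: "x \<in> carrier L" for x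
    proof -
      obtain y where "y \<in> carrier L" "\<not> y \<sqsubseteq> x" using unbounded x by blast
      then show ?thesis
        using u0 u1 by (intro bexI[of _ "(u0 \<squnion> u1) \<squnion> y"]) (auto simp: join_left join_right)
    qed
    then have no_max: False
      if "x \<in> carrier L" "\<And>u. u \<in> carrier L \<Longrightarrow> u0 \<squnion> u1 \<sqsubseteq> u \<Longrightarrow> u = x" for x
      using that by blast
    have closed: "lterm_val (add_top L) w p \<in> carrier (add_top L)"
      "lterm_val (add_top L) w q \<in> carrier (add_top L)"
      using w by (rule L1.lterm_val_closed)+
    consider (none) "lterm_val (add_top L) w p = None" "lterm_val (add_top L) w q = None"
      | (left) x where "lterm_val (add_top L) w p = Some x" "lterm_val (add_top L) w q = None"
      | (right) x where "lterm_val (add_top L) w p = None" "lterm_val (add_top L) w q = Some x"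
      | (both) x y where "lterm_val (add_top L) w p = Some x" "lterm_val (add_top L) w q = Some y"
      by fastforce
    then show ?thesis
    proof cases
      case none
      then show ?thesis by simp
    next
      case left
      then show ?thesis using no_max[of x] eq closed by auto
    next
      case right
      then show ?thesis using no_max[of x] eq closed by auto
    next
      case both
      then show ?thesis using eq[of "u0 \<squnion> u1"] u0(1) u1(1) by simp
    qed
  qed
qed

end

section \<open>Lattice terms evaluated on filters\<close>

context meet_rules
begin

interpretation L1: lattice "add_top L"
  by (rule lattice_add_top)

interpretation K: complete_lattice K
  by (rule complete_lattice_K)

text \<open>The empty filter stands for the new largest element; it is closed only if \<open>L\<close> has no
  largest element.\<close>

definition choices :: "'a set \<Rightarrow> 'a option set" where
  "choices F = Some ` F \<union> (if tops = {} then {None} else {})"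

text \<open>The value of \<open>p\<close> in the lattice of all filters, before closure. Expressing
  it through single choices \<open>w\<close> lets identities be applied one choice at a
  time.\<close>

definition filter_val :: "(nat \<Rightarrow> 'a set) \<Rightarrow> lterm \<Rightarrow> 'a set" where
  "filter_val F p = {x \<in> carrier L. \<exists>w. (\<forall>i. w i \<in> choices (F i)) \<and>
     lterm_val (add_top L) w p \<sqsubseteq>\<^bsub>add_top L\<^esub> Some x}"

lemma choices_meet:
  assumes "closed F" "x \<in> choices F" "y \<in> choices F"
  shows "x \<sqinter>\<^bsub>add_top L\<^esub> y \<in> choices F"
  using assms closed_filterD[OF assms(1)] by (auto simp: choices_def split: if_splits)

lemma choices_carrier: "closed F \<Longrightarrow> choices F \<subseteq> carrier (add_top L)"
  using closed_filterD(1) by (auto simp: choices_def)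

lemma choices_nonempty: "closed F \<Longrightarrow> choices F \<noteq> {}"
  using closedD(2) by (auto simp: choices_def)

context
  fixes F :: "nat \<Rightarrow> 'a set"
  assumes F: "\<And>i. closed (F i)"
begin

lemma choices_range: "(\<And>i. w i \<in> choices (F i)) \<Longrightarrow> range w \<subseteq> carrier (add_top L)"
  using choices_carrier[OF F] by blast

text \<open>Take the pointwise meet of the two choices; terms are monotone.\<close>

lemma filter_val_common:
  assumes "x \<in> filter_val F p" "y \<in> filter_val F q"
  shows "\<exists>w. (\<forall>i. w i \<in> choices (F i)) \<and> lterm_val (add_top L) w p \<sqsubseteq>\<^bsub>add_top L\<^esub> Some x \<and>
    lterm_val (add_top L) w q \<sqsubseteq>\<^bsub>add_top L\<^esub> Some y"
proof -
  obtain v w where v: "\<And>i. v i \<in> choices (F i)" "lterm_val (add_top L) v p \<sqsubseteq>\<^bsub>add_top L\<^esub> Some x"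
    and w: "\<And>i. w i \<in> choices (F i)" "lterm_val (add_top L) w q \<sqsubseteq>\<^bsub>add_top L\<^esub> Some y"
    using assms unfolding filter_val_def by blast
  have xy: "Some x \<in> carrier (add_top L)" "Some y \<in> carrier (add_top L)"
    using assms by (auto simp: filter_val_def)
  define u where "u i = v i \<sqinter>\<^bsub>add_top L\<^esub> w i" for i
  have u: "\<And>i. u i \<in> choices (F i)"
    using v w F by (simp add: u_def choices_meet)
  note ranges = choices_range[OF v(1)] choices_range[OF w(1)] choices_range[OF u]
  have "\<And>i. u i \<sqsubseteq>\<^bsub>add_top L\<^esub> v i" "\<And>i. u i \<sqsubseteq>\<^bsub>add_top L\<^esub> w i"
    unfolding u_def using ranges by (blast intro: L1.meet_left L1.meet_right)+
  then have "lterm_val (add_top L) u p \<sqsubseteq>\<^bsub>add_top L\<^esub> lterm_val (add_top L) v p"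
    "lterm_val (add_top L) u q \<sqsubseteq>\<^bsub>add_top L\<^esub> lterm_val (add_top L) w q"
    using ranges by (simp_all add: L1.lterm_val_mono del: carrier_add_top)
  then have "lterm_val (add_top L) u p \<sqsubseteq>\<^bsub>add_top L\<^esub> Some x"
    "lterm_val (add_top L) u q \<sqsubseteq>\<^bsub>add_top L\<^esub> Some y"
    using v(2) w(2) ranges[THEN L1.lterm_val_closed] xy L1.le_trans by blast+
  with u show ?thesis by blast
qed

lemma is_filter_filter_val: "is_filter (filter_val F p)"
  unfolding is_filter_def
proof (intro conjI ballI impI)
  show "filter_val F p \<subseteq> carrier L" by (auto simp: filter_val_def)
next
  fix x y assume x: "x \<in> filter_val F p" and y: "y \<in> carrier L" "x \<sqsubseteq> y"
  then have xy: "Some x \<in> carrier (add_top L)" "Some y \<in> carrier (add_top L)"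
    by (auto simp: filter_val_def)
  obtain w where w: "\<And>i. w i \<in> choices (F i)" "lterm_val (add_top L) w p \<sqsubseteq>\<^bsub>add_top L\<^esub> Some x"
    using x unfolding filter_val_def by blast
  have "lterm_val (add_top L) w p \<sqsubseteq>\<^bsub>add_top L\<^esub> Some y"
    using L1.le_trans[OF w(2) _ _ xy] y(2) L1.lterm_val_closed[OF choices_range[OF w(1)]] by simp
  then show "y \<in> filter_val F p"
    using w(1) y(1) by (auto simp: filter_val_def)
next
  fix x y assume x: "x \<in> filter_val F p" and y: "y \<in> filter_val F p"
  then have xy: "x \<in> carrier L" "y \<in> carrier L"
    by (auto simp: filter_val_def)
  obtain w where w: "\<And>i. w i \<in> choices (F i)" "lterm_val (add_top L) w p \<sqsubseteq>\<^bsub>add_top L\<^esub> Some x"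
    "lterm_val (add_top L) w p \<sqsubseteq>\<^bsub>add_top L\<^esub> Some y"
    using filter_val_common[OF x y] by blast
  have "lterm_val (add_top L) w p \<sqsubseteq>\<^bsub>add_top L\<^esub> Some (x \<sqinter> y)"
    using L1.meet_le[OF w(2,3)] L1.lterm_val_closed[OF choices_range[OF w(1)]] xy by simp
  then show "x \<sqinter> y \<in> filter_val F p"
    using w(1) xy by (auto simp: filter_val_def)
qed

lemma filter_val_Var: "filter_val F (LVar n) = F n"
proof
  show "filter_val F (LVar n) \<subseteq> F n"
  proof
    fix x assume x: "x \<in> filter_val F (LVar n)"
    then obtain w where w: "w n \<in> choices (F n)" "w n \<sqsubseteq>\<^bsub>add_top L\<^esub> Some x"
      by (auto simp: filter_val_def)
    then obtain y where "y \<in> F n" "y \<sqsubseteq> x"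
      by (cases "w n") (auto simp: choices_def split: if_splits)
    then show "x \<in> F n"
      using closed_filterD(2)[OF F] x by (auto simp: filter_val_def)
  qed
  show "F n \<subseteq> filter_val F (LVar n)"
  proof
    fix x assume x: "x \<in> F n"
    then have xc: "x \<in> carrier L" using closed_filterD(1)[OF F] by blast
    \<comment> \<open>The other variables do not occur in the term, but \<open>w\<close> must still
      choose something for them; this is why \<open>choices\<close> has to be nonempty.\<close>
    define w where "w i = (if i = n then Some x else (SOME y. y \<in> choices (F i)))" for i
    have "w i \<in> choices (F i)" for i
    proof (cases "i = n")
      case True
      then show ?thesis using x by (simp add: w_def choices_def)
    next
      case False
      then show ?thesis using choices_nonempty[OF F, of i] by (simp add: w_def some_in_eq)
    qed
    moreover have "w n \<sqsubseteq>\<^bsub>add_top L\<^esub> Some x" using xc by (simp add: w_def)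
    ultimately show "x \<in> filter_val F (LVar n)"
      using xc by (auto simp: filter_val_def)
  qed
qed

lemma filter_val_Join: "filter_val F (LJoin p q) = filter_val F p \<inter> filter_val F q"
proof
  show "filter_val F (LJoin p q) \<subseteq> filter_val F p \<inter> filter_val F q"
  proof
    fix x assume x: "x \<in> filter_val F (LJoin p q)"
    then obtain w where w: "\<And>i. w i \<in> choices (F i)"
      "lterm_val (add_top L) w (LJoin p q) \<sqsubseteq>\<^bsub>add_top L\<^esub> Some x" "x \<in> carrier L"
      unfolding filter_val_def by blast
    then have "lterm_val (add_top L) w p \<sqsubseteq>\<^bsub>add_top L\<^esub> Some x \<and>
        lterm_val (add_top L) w q \<sqsubseteq>\<^bsub>add_top L\<^esub> Some x"
      using L1.lterm_val_closed[OF choices_range[OF w(1)]]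
      by (simp add: L1.join_le_iff)
    then show "x \<in> filter_val F p \<inter> filter_val F q"
      using w by (auto simp: filter_val_def)
  qed
  show "filter_val F p \<inter> filter_val F q \<subseteq> filter_val F (LJoin p q)"
  proof
    fix x assume x: "x \<in> filter_val F p \<inter> filter_val F q"
    then have xc: "x \<in> carrier L" by (simp add: filter_val_def)
    obtain w where w: "\<And>i. w i \<in> choices (F i)" "lterm_val (add_top L) w p \<sqsubseteq>\<^bsub>add_top L\<^esub> Some x"
      "lterm_val (add_top L) w q \<sqsubseteq>\<^bsub>add_top L\<^esub> Some x"
      using filter_val_common[OF IntD1[OF x] IntD2[OF x]] by blast
    have "lterm_val (add_top L) w (LJoin p q) \<sqsubseteq>\<^bsub>add_top L\<^esub> Some x"
      using w L1.lterm_val_closed[OF choices_range[OF w(1)]] xc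
      by (simp add: L1.join_le_iff)
    then show "x \<in> filter_val F (LJoin p q)"
      using w(1) xc unfolding filter_val_def by blast
  qed
qed

lemma filter_val_subset_Meet:
  "filter_val F p \<subseteq> filter_val F (LMeet p q)" "filter_val F q \<subseteq> filter_val F (LMeet p q)"
proof -
  have "x \<in> filter_val F (LMeet p q)" if x: "x \<in> filter_val F r" and r: "r = p \<or> r = q" for x r
  proof -
    obtain w where w: "\<And>i. w i \<in> choices (F i)"
      "lterm_val (add_top L) w r \<sqsubseteq>\<^bsub>add_top L\<^esub> Some x" "x \<in> carrier L"
      using x unfolding filter_val_def by blast
    note cl = L1.lterm_val_closed[OF choices_range[OF w(1)]]
    have "lterm_val (add_top L) w (LMeet p q) \<sqsubseteq>\<^bsub>add_top L\<^esub> Some x"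
      using w(2,3) r cl[of p] cl[of q] by (auto intro: L1.meet_leI1 L1.meet_leI2)
    then show ?thesis
      using w(1,3) unfolding filter_val_def by blast
  qed
  then show "filter_val F p \<subseteq> filter_val F (LMeet p q)" "filter_val F q \<subseteq> filter_val F (LMeet p q)"
    by blast+
qed

lemma filter_val_Meet_subset:
  "filter_val F (LMeet p q) \<subseteq> filter_sup (filter_val F p) (filter_val F q)"
proof
  fix x assume x: "x \<in> filter_val F (LMeet p q)"
  then obtain w where w: "\<And>i. w i \<in> choices (F i)"
    "lterm_val (add_top L) w (LMeet p q) \<sqsubseteq>\<^bsub>add_top L\<^esub> Some x" "x \<in> carrier L"
    unfolding filter_val_def by blast
  note cl = L1.lterm_val_closed[OF choices_range[OF w(1)]]
  have mem: "y \<in> filter_val F r"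
    if "lterm_val (add_top L) w r \<sqsubseteq>\<^bsub>add_top L\<^esub> Some y" "y \<in> carrier L" for r y
    using that w(1) unfolding filter_val_def by blast
  show "x \<in> filter_sup (filter_val F p) (filter_val F q)"
  \<comment> \<open>A factor \<open>None\<close> is neutral in the meet, so the other factor alone
    is already below \<open>x\<close>.\<close>
  proof (cases "lterm_val (add_top L) w p = None \<or> lterm_val (add_top L) w q = None")
    case True
    then have "lterm_val (add_top L) w p \<sqsubseteq>\<^bsub>add_top L\<^esub> Some x \<or>
        lterm_val (add_top L) w q \<sqsubseteq>\<^bsub>add_top L\<^esub> Some x"
      using w(2) cl[of p] cl[of q] by auto
    then show ?thesis
      using mem w(3) by (auto simp: filter_sup_def)
  next
    case False
    then obtain y z where yz: "lterm_val (add_top L) w p = Some y" "lterm_val (add_top L) w q = Some z"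
      by auto
    then have "y \<in> carrier L" "z \<in> carrier L"
      using cl[of p] cl[of q] by auto
    then have "y \<in> filter_val F p" "z \<in> filter_val F q" "y \<sqinter> z \<sqsubseteq> x"
      using mem yz w(2) by auto
    then show ?thesis
      using w(3) by (auto simp: filter_sup_def)
  qed
qed

text \<open>The closure respects both operations, so it may be postponed to the end of the
  evaluation.\<close>

lemma lterm_val_K: "lterm_val K F p = cl (filter_val F p)"
proof (induction p)
  case (LVar n)
  then show ?case using F by (simp add: filter_val_Var cl_closed)
next
  case (LJoin p q)
  then show ?case
    by (simp add: join_K closed_cl is_filter_filter_val cl_Int filter_val_Join)
next
  case (LMeet p q)
  let ?p = "filter_val F p" and ?q = "filter_val F q" and ?m = "filter_val F (LMeet p q)"
  have p: "closed (cl ?p)" and q: "closed (cl ?q)" and m: "closed (cl ?m)"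
    by (intro closed_cl is_filter_filter_val)+
  have fil: "is_filter (filter_sup (cl ?p) (cl ?q))"
    using p q by (intro is_filter_sup closedD)
  have "lterm_val K F (LMeet p q) = cl (filter_sup (cl ?p) (cl ?q))"
    using LMeet p q by (simp add: meet_K)
  also have "\<dots> = cl ?m"
  proof
    have "cl ?p \<subseteq> cl ?m" "cl ?q \<subseteq> cl ?m"
      using cl_mono[OF filter_val_subset_Meet(1)] cl_mono[OF filter_val_subset_Meet(2)] by blast+
    then show "cl (filter_sup (cl ?p) (cl ?q)) \<subseteq> cl ?m"
      by (rule cl_least[OF m, OF filter_sup_least[OF closedD(1)[OF m]]])
    have "filter_sup ?p ?q \<subseteq> filter_sup (cl ?p) (cl ?q)"
      using cl_extensive[OF is_filter_filter_val[of p]] cl_extensive[OF is_filter_filter_val[of q]]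
      unfolding filter_sup_def by blast
    then show "cl ?m \<subseteq> cl (filter_sup (cl ?p) (cl ?q))"
      using filter_val_Meet_subset[of p q] cl_extensive[OF fil]
      by (intro cl_least closed_cl[OF fil]) blast
  qed
  finally show ?case .
qed

lemma filter_val_identity:
  assumes "\<And>v. range v \<subseteq> carrier L \<Longrightarrow> lterm_val L v p = lterm_val L v q"
  shows "filter_val F p = filter_val F q"
proof -
  have "lterm_val (add_top L) w p = lterm_val (add_top L) w q"
    if w: "\<And>i. w i \<in> choices (F i)" for w
  proof (rule identity_add_top[OF assms choices_range[OF w]])
    \<comment> \<open>\<open>None\<close> is offered as a choice only if \<open>L\<close> has no
      largest element, which is what \<open>identity_add_top\<close> asks for.\<close>
    show "None \<notin> range w \<or> (\<forall>x\<in>carrier L. \<exists>y\<in>carrier L. \<not> y \<sqsubseteq> x)"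
    proof (cases "tops = {}")
      case True
      then show ?thesis unfolding tops_def by blast
    next
      case False
      then have "w i \<noteq> None" for i using w[of i] by (auto simp: choices_def)
      then show ?thesis by (metis rangeE)
    qed
  qed
  then show ?thesis
    unfolding filter_val_def by (metis (no_types, lifting))
qed

end

lemma in_variety_K: "in_variety_generated_by K L"
  unfolding in_variety_generated_by_def
proof (intro conjI allI impI)
  show "lattice K" by (rule K.lattice_axioms)
  fix S assume S: "satisfies_identities L S"
  have "lterm_val K F p = lterm_val K F q" if "(p, q) \<in> S" "range F \<subseteq> carrier K" for p q F
  proof -
    have F: "\<And>i. closed (F i)" using that(2) by auto
    have "filter_val F p = filter_val F q"
      using S that(1) unfolding satisfies_identities_def
      by (intro filter_val_identity F) blast
    then show ?thesis by (simp add: lterm_val_K F)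
  qed
  then show "satisfies_identities K S"
    unfolding satisfies_identities_def by blast
qed

end


section \<open>The rules given by the axiom\<close>

context lattice
begin

interpretation L1: lattice "add_top L"
  by (rule lattice_add_top)

lemma star_ge:
  assumes "a \<in> carrier L" "t \<in> lists (carrier L)"
  shows "Some a \<sqsubseteq>\<^bsub>add_top L\<^esub> star L a t"
proof (cases t rule: rev_cases)
  case (snoc t' b)
  then have "star L a t' \<in> carrier (add_top L)" "Some b \<in> carrier (add_top L)"
    "Some a \<in> carrier (add_top L)"
    using assms star_closed by auto
  then show ?thesis
    unfolding snoc star_simps by (intro L1.join_left L1.meet_closed)
qed (simp add: star_simps)

text \<open>Below, \<open>s\<close> is either extended by \<open>x\<close>, or \<open>x\<close> is absorbed into its last entry. If \<open>s\<close> is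
  empty, then the join with which \<open>lozenge\<close> starts is made trivial by the bound \<open>a\<close>.\<close>

lemma lozenge_join:
  assumes s: "s \<in> lists (carrier L)" and x: "x \<in> carrier L"
  obtains s' where "s' \<in> lists (carrier L)"
    "\<And>y. y \<in> carrier (add_top L) \<Longrightarrow> lozenge L s' y = Some x \<squnion>\<^bsub>add_top L\<^esub> lozenge L s y"
proof (cases "even (length s)")
  case True
  then show thesis
    using that[of "s @ [x]"] s x by (simp add: lozenge_simps)
next
  case False
  then obtain r e where r: "s = r @ [e]" "even (length r)"
    by (cases s rule: rev_cases) auto
  then have rl: "r \<in> lists (carrier L)" "e \<in> carrier L" using s by auto
  have "lozenge L (r @ [x \<squnion> e]) y = Some x \<squnion>\<^bsub>add_top L\<^esub> lozenge L s y"
    if y: "y \<in> carrier (add_top L)" for y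
    using lozenge_closed[OF rl(1) y] r(2) x rl(2)
    by (auto simp: r(1) lozenge_simps join_assoc)
  then show thesis
    using that[of "r @ [x \<squnion> e]"] rl x by simp
qed

lemma lozenge_meet:
  assumes s: "s \<in> lists (carrier L)" and x: "x \<in> carrier L" and a: "a \<in> carrier L"
  obtains s' where "s' \<in> lists (carrier L)"
    "\<And>y. y \<in> carrier (add_top L) \<Longrightarrow> Some a \<sqsubseteq>\<^bsub>add_top L\<^esub> y \<Longrightarrow>
      lozenge L s' y = Some x \<sqinter>\<^bsub>add_top L\<^esub> lozenge L s y"
proof (cases "even (length s)")
  case False
  then show thesis
    using that[of "s @ [x]"] s x by (simp add: lozenge_simps)
next
  case True
  show thesis
  proof (cases s rule: rev_cases)
    case Nil
    have "lozenge L [a, x] y = Some x \<sqinter>\<^bsub>add_top L\<^esub> lozenge L s y"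
      if "y \<in> carrier (add_top L)" "Some a \<sqsubseteq>\<^bsub>add_top L\<^esub> y" for y
      using that x a L1.le_iff_meet[of "Some a" y]
      by (simp add: Nil lozenge_def)
    then show thesis using that[of "[a, x]"] a x by simp
  next
    case (snoc r e)
    then have rl: "r \<in> lists (carrier L)" "e \<in> carrier L" "odd (length r)"
      using s True by auto
    have "lozenge L (r @ [x \<sqinter> e]) y = Some x \<sqinter>\<^bsub>add_top L\<^esub> lozenge L s y"
      if y: "y \<in> carrier (add_top L)" for y
      using lozenge_closed[OF rl(1) y] rl(2,3) x
      by (auto simp: snoc lozenge_simps meet_assoc)
    then show thesis
      using that[of "r @ [x \<sqinter> e]"] rl x by simp
  qed
qed

text \<open>Values \<open>None\<close> are dropped from the premises, since a filter has only
  elements of \<open>L\<close>; they impose no condition on a meet.\<close>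

definition stair_rule :: "'a set \<Rightarrow> 'a \<Rightarrow> bool" where
  "stair_rule P m \<longleftrightarrow> (\<exists>s\<in>lists (carrier L). \<exists>a\<in>carrier L. \<exists>b\<in>carrier L. \<exists>c\<in>carrier L.
     P = {p. \<exists>t\<in>lists {b, c}. Some p = lozenge L s (star L a t)} \<and>
     Some m = lozenge L s (Some (a \<squnion> (b \<sqinter> c))))"

lemma meet_rules_stair_rule:
  assumes SD: "SD_join_omega L"
  shows "meet_rules L stair_rule"
proof
  have T: "t \<in> lists (carrier L)" if "t \<in> lists {b, c}" "b \<in> carrier L" "c \<in> carrier L" for t b c
    using that by (induction t) auto
  {
    fix P m
    assume "stair_rule P m"
    then obtain s a b c where s: "s \<in> lists (carrier L)" and abc: "a \<in> carrier L" "b \<in> carrier L"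
      "c \<in> carrier L" and P: "P = {p. \<exists>t\<in>lists {b, c}. Some p = lozenge L s (star L a t)}"
      and m: "Some m = lozenge L s (Some (a \<squnion> (b \<sqinter> c)))"
      unfolding stair_rule_def by blast
    let ?e = "a \<squnion> (b \<sqinter> c)"
    \<comment> \<open>The bounds by \<open>a\<close>, here and for \<open>star\<close>, are what
      \<open>lozenge_meet\<close> requires.\<close>
    have e: "Some ?e \<in> carrier (add_top L)" "Some a \<sqsubseteq>\<^bsub>add_top L\<^esub> Some ?e"
      using abc by (simp_all add: join_left)
    have star: "star L a t \<in> carrier (add_top L)" "Some a \<sqsubseteq>\<^bsub>add_top L\<^esub> star L a t"
      "lozenge L s (star L a t) \<in> carrier (add_top L)" if "t \<in> lists {b, c}" for t
      using T[OF that] abc s by (simp_all only: star_closed star_ge lozenge_closed)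
    have mc: "m \<in> carrier L"
      using lozenge_Some[OF s, of ?e] abc m[symmetric] by auto
    have "P \<subseteq> carrier L"
    proof
      fix p assume "p \<in> P"
      then obtain t where "t \<in> lists {b, c}" "Some p = lozenge L s (star L a t)"
        using P by blast
      then have "Some p \<in> carrier (add_top L)" using star(3) by simp
      then show "p \<in> carrier L" by auto
    qed
    with mc show "P \<subseteq> carrier L \<and> m \<in> carrier L" by blast
    {
      fix x assume x: "x \<in> carrier L"
      obtain s' where s': "s' \<in> lists (carrier L)" "\<And>y. y \<in> carrier (add_top L) \<Longrightarrow>
          lozenge L s' y = Some x \<squnion>\<^bsub>add_top L\<^esub> lozenge L s y"
        by (rule lozenge_join[OF s x]) blast
      let ?P = "{p. \<exists>t\<in>lists {b, c}. Some p = lozenge L s' (star L a t)}"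
      have "Some (x \<squnion> m) = lozenge L s' (Some ?e)"
        using s'(2)[OF e(1)] x mc by (simp flip: m)
      then have "stair_rule ?P (x \<squnion> m)"
        unfolding stair_rule_def using s'(1) abc by blast
      moreover have "?P \<subseteq> (\<lambda>p. x \<squnion> p) ` P"
      proof
        fix p assume "p \<in> ?P"
        then obtain t where t: "t \<in> lists {b, c}" "Some p = lozenge L s' (star L a t)"
          by blast
        then have p: "Some p = Some x \<squnion>\<^bsub>add_top L\<^esub> lozenge L s (star L a t)"
          using s'(2)[OF star(1)[OF t(1)]] by simp
        \<comment> \<open>A join with \<open>None\<close> would be \<open>None\<close>, so the old
          value is proper.\<close>
        then obtain r where r: "lozenge L s (star L a t) = Some r" "r \<in> carrier L"
          using star(3)[OF t(1)] x by auto
        then have "p = x \<squnion> r"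
          using p x by simp
        moreover have "r \<in> P"
          unfolding P using t(1) r(1) by (intro CollectI bexI[of _ t]) simp_all
        ultimately show "p \<in> (\<lambda>p. x \<squnion> p) ` P"
          by blast
      qed
      ultimately show "\<exists>P'. stair_rule P' (x \<squnion> m) \<and> P' \<subseteq> (\<lambda>p. x \<squnion> p) ` P"
        by blast
    next
      fix x assume x: "x \<in> carrier L"
      obtain s' where s': "s' \<in> lists (carrier L)" "\<And>y. y \<in> carrier (add_top L) \<Longrightarrow>
          Some a \<sqsubseteq>\<^bsub>add_top L\<^esub> y \<Longrightarrow> lozenge L s' y = Some x \<sqinter>\<^bsub>add_top L\<^esub> lozenge L s y"
        by (rule lozenge_meet[OF s x abc(1)]) blast
      let ?P = "{p. \<exists>t\<in>lists {b, c}. Some p = lozenge L s' (star L a t)}"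
      have "Some (x \<sqinter> m) = lozenge L s' (Some ?e)"
        using s'(2)[OF e] x mc by (simp flip: m)
      then have "stair_rule ?P (x \<sqinter> m)"
        unfolding stair_rule_def using s'(1) abc by blast
      moreover have "?P \<subseteq> insert x ((\<lambda>p. x \<sqinter> p) ` P)"
      proof
        fix p assume "p \<in> ?P"
        then obtain t where t: "t \<in> lists {b, c}" "Some p = lozenge L s' (star L a t)"
          by blast
        then have p: "Some p = Some x \<sqinter>\<^bsub>add_top L\<^esub> lozenge L s (star L a t)"
          using s'(2)[OF star(1,2)[OF t(1)]] by simp
        show "p \<in> insert x ((\<lambda>p. x \<sqinter> p) ` P)"
        \<comment> \<open>If the old value is the new top, its meet with \<open>x\<close> is
          \<open>x\<close> itself, the additional premise allowed by
          \<open>rule_meet\<close>.\<close>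
        proof (cases "lozenge L s (star L a t)")
          case None
          then show ?thesis using p x by simp
        next
          case (Some r)
          then have "p = x \<sqinter> r"
            using p x star(3)[OF t(1)] by auto
          moreover have "r \<in> P"
            unfolding P using t(1) Some by (intro CollectI bexI[of _ t]) simp_all
          ultimately show ?thesis by blast
        qed
      qed
      ultimately show "\<exists>P'. stair_rule P' (x \<sqinter> m) \<and> P' \<subseteq> insert x ((\<lambda>p. x \<sqinter> p) ` P)"
        by blast
    next
      fix x assume x: "x \<in> carrier L" and le: "\<And>p. p \<in> P \<Longrightarrow> x \<sqsubseteq> p"
      let ?X = "{lozenge L s (star L a t) | t. t \<in> lists {b, c}}"
      have X: "?X \<subseteq> carrier (add_top L)"
        using star(3) by (simp only: subset_iff mem_Collect_eq) metis
      have "is_glb (add_top L) (Some m) ?X"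
        using SD s abc unfolding SD_join_omega_def m by blast
      moreover have "Some x \<sqsubseteq>\<^bsub>add_top L\<^esub> y" if y: "y \<in> ?X" for y
      proof (cases y)
        case (Some p)
        then have "p \<in> P" using y P by force
        then show ?thesis using le Some by simp
      qed simp
      ultimately have "Some x \<sqsubseteq>\<^bsub>add_top L\<^esub> Some m"
        using x unfolding is_glb_iff[OF X] by simp
      then show "x \<sqsubseteq> m" by simp
    }
  }
  fix a b c D
  assume abc: "a \<in> carrier L" "b \<in> carrier L" "c \<in> carrier L" and D: "D \<subseteq> carrier L"
    and init: "a \<squnion> b \<in> D" "a \<squnion> c \<in> D"
    and step: "\<And>y. y \<in> D \<Longrightarrow> a \<squnion> (b \<sqinter> y) \<in> D \<and> a \<squnion> (c \<sqinter> y) \<in> D"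
  \<comment> \<open>The empty list gives \<open>None\<close>, outside \<open>D\<close>. The first
    proper value is \<open>a \<squnion> e\<close>, supplied by \<open>init\<close>; later ones come
    from \<open>step\<close>.\<close>
  have star_D: "star L a t \<in> insert None (Some ` D)" if "t \<in> lists {b, c}" for t
    using that
  proof (induction t rule: rev_induct)
    case (snoc e t)
    then have e: "e = b \<or> e = c" and IH: "star L a t \<in> insert None (Some ` D)"
      by auto
    show ?case
    proof (cases "star L a t")
      case None
      then show ?thesis using e abc init by (auto simp: star_simps)
    next
      case (Some y)
      then have y: "y \<in> D" "y \<in> carrier L" using IH D by auto
      then show ?thesis using Some e abc step[OF y(1)] by (auto simp: star_simps)
    qed
  qed (simp add: star_simps)
  \<comment> \<open>With \<open>s = []\<close>, \<open>lozenge\<close> is the identity and the rule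
    speaks of the staircase itself.\<close>
  let ?P = "{p. \<exists>t\<in>lists {b, c}. Some p = lozenge L [] (star L a t)}"
  have "?P \<subseteq> D"
    using star_D by (fastforce simp: lozenge_simps)
  moreover have "stair_rule ?P (a \<squnion> (b \<sqinter> c))"
    unfolding stair_rule_def using abc
    by (intro bexI[of _ "[]"] bexI[of _ a] bexI[of _ b] bexI[of _ c]) (auto simp: lozenge_simps)
  ultimately show "\<exists>P\<subseteq>D. stair_rule P (a \<squnion> (b \<sqinter> c))"
    by blast
qed

end


section \<open>The equivalences\<close>

lemma SD_join_omega_imp_embeds:
  fixes L :: "'a gorder"
  assumes "lattice L" "SD_join_omega L"
  shows "embeds_join_complete_in_variety TYPE('a set) L"
proof -
  interpret lattice L by fact
  interpret meet_rules L stair_rule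
    by (rule meet_rules_stair_rule) fact
  show ?thesis
    unfolding embeds_join_complete_in_variety_def
    using complete_lattice_K lower_continuous_K join_semidistributive_K in_variety_K
      lattice_embedding_principal join_complete_principal by blast
qed

lemma embeds_join_complete_in_variety_imp_embeds_complete:
  "embeds_join_complete_in_variety TYPE('b) L \<Longrightarrow> embeds_complete TYPE('b) L"
  unfolding embeds_join_complete_in_variety_def embeds_complete_def by blast

lemma embeds_complete_imp_embeds_countably_complete:
  assumes "embeds_complete TYPE('b) L"
  shows "embeds_countably_complete TYPE('b) L"
proof -
  obtain K :: "'b gorder" and f where K: "complete_lattice K" "lower_continuous K"
    "join_semidistributive K" "lattice_embedding L K f"
    using assms unfolding embeds_complete_def by blast
  have "countably_meet_complete K"
    using complete_lattice.inf_exists[OF K(1)] by (simp add: countably_meet_complete_def)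
  moreover have "countably_lower_continuous K"
    using K(2) unfolding lower_continuous_def countably_lower_continuous_def by blast
  ultimately show ?thesis
    using K complete_lattice_lattice unfolding embeds_countably_complete_def by blast
qed

lemma embeds_countably_complete_imp_SD_join_omega:
  assumes "lattice L" "embeds_countably_complete TYPE('b) L"
  shows "SD_join_omega L"
proof -
  obtain K :: "'b gorder" and f where K: "lattice K" "countably_meet_complete K"
    "countably_lower_continuous K" "join_semidistributive K" "lattice_embedding L K f"
    using assms(2) unfolding embeds_countably_complete_def by blast
  interpret countably_continuous_lattice K
    using K by (simp add: countably_continuous_lattice_def countably_continuous_lattice_axioms_def)
  show ?thesis
    using assms(1) K(5) by (rule embeds_imp_SD_join_omega)
qed

text \<open>For targets in \<open>'a set\<close> the implications form a cycle through the axiom. An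
  arbitrary \<open>'b\<close> may be too small to carry the filter lattice, so there only the
  implications towards the axiom are asserted.\<close>

theorem theorem11p2:
  fixes L :: "'a gorder"
  assumes "lattice L"
  shows "((embeds_join_complete_in_variety TYPE('a set) L \<longleftrightarrow> SD_join_omega L) \<and>
          (embeds_complete TYPE('a set) L \<longleftrightarrow> SD_join_omega L) \<and>
          (embeds_countably_complete TYPE('a set) L \<longleftrightarrow> SD_join_omega L)) \<and>
         ((embeds_join_complete_in_variety TYPE('b) L \<longrightarrow> SD_join_omega L) \<and>
          (embeds_complete TYPE('b) L \<longrightarrow> SD_join_omega L) \<and>
          (embeds_countably_complete TYPE('b) L \<longrightarrow> SD_join_omega L))"
  using SD_join_omega_imp_embeds[OF assms]
    embeds_join_complete_in_variety_imp_embeds_complete[where 'b = "'a set" and L = L]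
    embeds_join_complete_in_variety_imp_embeds_complete[where 'b = 'b and L = L]
    embeds_complete_imp_embeds_countably_complete[where 'b = "'a set" and L = L]
    embeds_complete_imp_embeds_countably_complete[where 'b = 'b and L = L]
    embeds_countably_complete_imp_SD_join_omega[OF assms, where 'b = "'a set"]
    embeds_countably_complete_imp_SD_join_omega[OF assms, where 'b = 'b]
  by argo

end
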